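(* Let $F$ be a free group of rank two. For any prime $p$ and any $N > 0$, there exist infinitely many geodesics $\gamma$, each in a different connected component of $\Gamma_p(F)$, such that the length of each $\gamma$ is greater than $N$.
   Context: For a group $G$ and a prime $p$, the $p$-local commensurability graph $\Gamma_p(G)$ is the simple graph whose vertices are the finite-index subgroups of $G$, where two distinct vertices $A, B \leq G$ are adjacent if and only if $[A : A\cap B][B : A\cap B]$ is a power of $p$. The length of a path is its number of edges, the distance between two vertices of a component is the least length of a path joining them, and a geodesic is a path whose length equals the distance between its endpoints. *)

theory Defs
  imports
    "HOL-Algebra.Coset"
    "HOL-Computational_Algebra.Primes"
    "Graph_Theory.Pair_Digraph"
    "Graph_Theory.Digraph_Component"
    "Graph_Theory.Vertex_Walk"
begin

text \<open>
  A letter \<open>(x, e)\<close> stands for \<open>x\<close> if \<open>e\<close> holds and for the inverse of \<open>x\<close> otherwise.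
  A group is free on \<open>S\<close> if each of its elements is the value of exactly one reduced word
  over \<open>S\<close>; lemma \<open>free_basis_universal\<close> below derives the universal property from this.
\<close>

definition letter_value :: "('a, 'm) monoid_scheme \<Rightarrow> 'a \<times> bool \<Rightarrow> 'a" where
  "letter_value G c = (if snd c then fst c else inv\<^bsub>G\<^esub> (fst c))"

definition word_value :: "('a, 'm) monoid_scheme \<Rightarrow> ('a \<times> bool) list \<Rightarrow> 'a" where
  "word_value G w = foldr (\<otimes>\<^bsub>G\<^esub>) (map (letter_value G) w) \<one>\<^bsub>G\<^esub>"

definition reduced_word :: "('a \<times> bool) list \<Rightarrow> bool" where
  "reduced_word w \<longleftrightarrow> successively (\<lambda>c d. \<not> (fst c = fst d \<and> snd c \<noteq> snd d)) w"

definition reduced_words :: "'a set \<Rightarrow> ('a \<times> bool) list set" where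
  "reduced_words S = {w. fst ` set w \<subseteq> S \<and> reduced_word w}"

definition free_basis :: "('a, 'm) monoid_scheme \<Rightarrow> 'a set \<Rightarrow> bool" where
  "free_basis G S \<longleftrightarrow>
     S \<subseteq> carrier G \<and> bij_betw (word_value G) (reduced_words S) (carrier G)"

definition free_group_of_rank :: "('a, 'm) monoid_scheme \<Rightarrow> nat \<Rightarrow> bool" where
  "free_group_of_rank G n \<longleftrightarrow>
     group G \<and> (\<exists>S. free_basis G S \<and> finite S \<and> card S = n)"

lemma word_value_simps [simp]:
  "word_value G [] = \<one>\<^bsub>G\<^esub>"
  "word_value G (c # w) = letter_value G c \<otimes>\<^bsub>G\<^esub> word_value G w"
  by (simp_all add: word_value_def)

lemma letter_value_closed:
  assumes "group G" "fst c \<in> carrier G"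
  shows "letter_value G c \<in> carrier G"
  using assms by (simp add: letter_value_def group.inv_closed)

lemma word_value_closed:
  assumes "group G" "fst ` set w \<subseteq> carrier G"
  shows "word_value G w \<in> carrier G"
proof -
  interpret group G by fact
  show ?thesis
    using assms(2) by (induction w) (auto simp: letter_value_closed[OF assms(1)])
qed

lemma word_value_append:
  assumes "group G" "fst ` set v \<subseteq> carrier G" "fst ` set w \<subseteq> carrier G"
  shows "word_value G (v @ w) = word_value G v \<otimes>\<^bsub>G\<^esub> word_value G w"
proof -
  interpret group G by fact
  show ?thesis
    using assms(2)
    by (induction v)
      (auto simp: m_assoc letter_value_closed[OF assms(1)] word_value_closed[OF assms(1)] assms(3))
qed

fun push_letter :: "'a \<times> bool \<Rightarrow> ('a \<times> bool) list \<Rightarrow> ('a \<times> bool) list" where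
  "push_letter c [] = [c]"
| "push_letter c (d # w) = (if fst c = fst d \<and> snd c \<noteq> snd d then w else c # d # w)"

definition reduce_word :: "('a \<times> bool) list \<Rightarrow> ('a \<times> bool) list" where
  "reduce_word w = foldr push_letter w []"

lemma reduce_word_simps [simp]:
  "reduce_word [] = []"
  "reduce_word (c # w) = push_letter c (reduce_word w)"
  by (simp_all add: reduce_word_def)

lemma set_push_letter: "set (push_letter c w) \<subseteq> insert c (set w)"
  by (cases w) auto

lemma reduced_push_letter: "reduced_word w \<Longrightarrow> reduced_word (push_letter c w)"
  by (cases w) (auto simp: reduced_word_def successively_Cons)

lemma set_reduce_word: "set (reduce_word w) \<subseteq> set w"
  by (induction w) (use set_push_letter in fastforce)+

lemma reduced_reduce_word: "reduced_word (reduce_word w)"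
  by (induction w) (auto intro: reduced_push_letter simp: reduced_word_def[of "[]"])

lemma word_value_push_letter:
  assumes "group H" "f ` fst ` set (c # w) \<subseteq> carrier H"
  shows "word_value H (map (apfst f) (push_letter c w)) =
         word_value H (map (apfst f) (c # w))"
proof (cases w)
  case (Cons d v)
  interpret group H by fact
  have c: "f (fst c) \<in> carrier H" and v: "f ` fst ` set v \<subseteq> carrier H"
    using assms(2) Cons by auto
  have vc: "word_value H (map (apfst f) v) \<in> carrier H"
    by (rule word_value_closed[OF assms(1)]) (use v in \<open>auto simp: image_image\<close>)
  have "letter_value H (apfst f c) \<otimes>\<^bsub>H\<^esub> (letter_value H (apfst f d) \<otimes>\<^bsub>H\<^esub> x) = x"
    if "fst c = fst d" "snd c \<noteq> snd d" "x \<in> carrier H" for x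
    using that c by (cases c; cases d) (auto simp: letter_value_def m_assoc[symmetric])
  then show ?thesis
    using Cons vc by simp
qed simp

lemma word_value_reduce_word:
  assumes "group H" "f ` fst ` set w \<subseteq> carrier H"
  shows "word_value H (map (apfst f) (reduce_word w)) =
         word_value H (map (apfst f) w)"
  using assms(2)
proof (induction w)
  case (Cons c w)
  have "f ` fst ` set (c # reduce_word w) \<subseteq> carrier H"
    using Cons.prems set_reduce_word[of w] by auto
  from word_value_push_letter[OF assms(1) this] show ?case
    using Cons by simp
qed simp

lemma hom_word_value:
  assumes "group G" "group H" "h \<in> hom G H" "fst ` set w \<subseteq> carrier G"
  shows "h (word_value G w) = word_value H (map (apfst h) w)"
proof -
  interpret group_hom G H h
    using assms by (simp add: group_hom_def group_hom_axioms_def)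
  have letter: "h (letter_value G c) = letter_value H (apfst h c)"
    if "fst c \<in> carrier G" for c
    using that by (cases c) (auto simp: letter_value_def)
  show ?thesis
    using assms(4)
    by (induction w)
      (auto simp: letter letter_value_closed[OF assms(1)] word_value_closed[OF assms(1)])
qed

lemma free_basis_universal:
  assumes G: "group G" "free_basis G S" and H: "group H" "f \<in> S \<rightarrow> carrier H"
  shows "\<exists>h \<in> hom G H. (\<forall>x\<in>S. h x = f x) \<and>
           (\<forall>h' \<in> hom G H. (\<forall>x\<in>S. h' x = f x) \<longrightarrow> (\<forall>g\<in>carrier G. h' g = h g))"
proof -
  interpret G: group G by fact
  interpret H: group H by fact
  have SG: "S \<subseteq> carrier G" and bij: "bij_betw (word_value G) (reduced_words S) (carrier G)"
    using G(2) by (auto simp: free_basis_def)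
  define nf where "nf = inv_into (reduced_words S) (word_value G)"
  have nf: "nf g \<in> reduced_words S" "word_value G (nf g) = g" if "g \<in> carrier G" for g
    using that bij unfolding nf_def
    by (auto simp: bij_betw_def inv_into_into f_inv_into_f)
  have nf_eq: "nf (word_value G w) = reduce_word w" if "fst ` set w \<subseteq> S" for w
  proof -
    have w: "fst ` set w \<subseteq> carrier G" using that SG by auto
    have red: "reduce_word w \<in> reduced_words S"
      using that set_reduce_word[of w] reduced_reduce_word[of w]
      by (auto simp: reduced_words_def)
    have "word_value G (reduce_word w) = word_value G w"
      using word_value_reduce_word[OF G(1), of "\<lambda>x. x" w] w
      by (simp add: apfst_def map_prod.identity[unfolded id_def] id_def)
    then show ?thesis
      using bij_betw_inv_into_left[OF bij red] by (simp add: nf_def)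
  qed
  have fS: "f ` fst ` set w \<subseteq> carrier H" if "fst ` set w \<subseteq> S" for w :: "('a \<times> bool) list"
    using that H(2) by auto
  have nfS: "fst ` set (nf g) \<subseteq> S" if "g \<in> carrier G" for g
    using nf(1)[OF that] by (simp add: reduced_words_def)
  define h where "h g = word_value H (map (apfst f) (nf g))" for g
  have h_word: "h (word_value G w) = word_value H (map (apfst f) w)"
    if "fst ` set w \<subseteq> S" for w
    using word_value_reduce_word[OF H(1) fS[OF that]] by (simp add: h_def nf_eq[OF that])
  have closed: "h g \<in> carrier H" if "g \<in> carrier G" for g
    unfolding h_def
    by (rule word_value_closed[OF H(1)]) (use fS[OF nfS[OF that]] in \<open>auto simp: image_image\<close>)
  have mult: "h (a \<otimes>\<^bsub>G\<^esub> b) = h a \<otimes>\<^bsub>H\<^esub> h b" if "a \<in> carrier G" "b \<in> carrier G" for a b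
  proof -
    have "a \<otimes>\<^bsub>G\<^esub> b = word_value G (nf a @ nf b)"
      using word_value_append[OF G(1), of "nf a" "nf b"] nfS that SG nf(2)
      by (metis order_trans)
    then have "h (a \<otimes>\<^bsub>G\<^esub> b) = word_value H (map (apfst f) (nf a) @ map (apfst f) (nf b))"
      using h_word[of "nf a @ nf b"] nfS that by auto
    also have "\<dots> = h a \<otimes>\<^bsub>H\<^esub> h b"
      unfolding h_def
      by (rule word_value_append[OF H(1)])
        (use fS[OF nfS[OF that(1)]] fS[OF nfS[OF that(2)]] in \<open>auto simp: image_image\<close>)
    finally show ?thesis .
  qed
  have ext: "h x = f x" if "x \<in> S" for x
  proof -
    have "f x \<in> carrier H" "x \<in> carrier G" using that H(2) SG by auto
    then show ?thesis
      using h_word[of "[(x, True)]"] that by (simp add: letter_value_def)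
  qed
  have uniq: "h' g = h g" if "h' \<in> hom G H" "\<forall>x\<in>S. h' x = f x" "g \<in> carrier G" for h' g
  proof -
    have "h' g = word_value H (map (apfst h') (nf g))"
      using hom_word_value[OF G(1) H(1) that(1), of "nf g"] nf(2)[OF that(3)] nfS[OF that(3)] SG
      by auto
    also have "map (apfst h') (nf g) = map (apfst f) (nf g)"
      using that(2) nfS[OF that(3)] by (auto simp: apfst_def map_prod_def split: prod.splits)
    finally show ?thesis by (simp add: h_def)
  qed
  show ?thesis
    using closed mult ext uniq by (intro bexI[of _ h]) (auto simp: hom_def)
qed

text \<open>
  An undirected simple graph is a loop-free symmetric digraph. Paths are nonempty lists of
  distinct vertices and may have length 0. The least element below is meaningful only
  if \<open>u\<close> and \<open>v\<close> are joined by a path.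
\<close>

definition path_distance :: "('a, 'b) pre_digraph \<Rightarrow> 'a \<Rightarrow> 'a \<Rightarrow> nat" where
  "path_distance \<Gamma> u v =
     (LEAST n. \<exists>q. vpath q \<Gamma> \<and> hd q = u \<and> last q = v \<and> vwalk_length q = n)"

definition geodesic :: "('a, 'b) pre_digraph \<Rightarrow> 'a vwalk \<Rightarrow> bool" where
  "geodesic \<Gamma> q \<longleftrightarrow> vpath q \<Gamma> \<and> vwalk_length q = path_distance \<Gamma> (hd q) (last q)"

text \<open>
  In a symmetric digraph, strongly connected components are connected components.
\<close>

abbreviation component_of :: "('a, 'b) pre_digraph \<Rightarrow> 'a \<Rightarrow> 'a set" where
  "component_of \<Gamma> \<equiv> pre_digraph.scc_of \<Gamma>"

lemma component_of_symmetric: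
  assumes "sym_digraph \<Gamma>"
  shows "component_of \<Gamma> u = {v. u \<rightarrow>\<^sup>*\<^bsub>\<Gamma>\<^esub> v}"
proof -
  interpret sym_digraph \<Gamma> by fact
  show ?thesis
    using symmetric_reachable[OF sym_arcs] by (auto simp: scc_of_def)
qed

lemma geodesic_subset_component:
  assumes "sym_digraph \<Gamma>" "geodesic \<Gamma> q"
  shows "set q \<subseteq> component_of \<Gamma> (hd q)"
proof -
  interpret sym_digraph \<Gamma> by fact
  have "vwalk q \<Gamma>" using assms(2) by (auto simp: geodesic_def vpath_def)
  then have "\<forall>v\<in>set q. hd q \<rightarrow>\<^sup>*\<^bsub>\<Gamma>\<^esub> v"
  proof (induction q)
    case (Cons u v es)
    then show ?case
      by (auto intro: adj_reachable_trans reachable_refl adj_in_verts)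
  qed auto
  then show ?thesis
    by (auto simp: component_of_symmetric[OF assms(1)])
qed

text \<open>
  \<open>subgroup_index G A B\<close> is the index of \<open>B\<close> in \<open>A\<close>, for subgroups \<open>B \<subseteq> A\<close> of \<open>G\<close>; it is the
  junk value 0 if that index is infinite.
\<close>

definition subgroup_index :: "('a, 'm) monoid_scheme \<Rightarrow> 'a set \<Rightarrow> 'a set \<Rightarrow> nat" where
  "subgroup_index G A B = card (rcosets\<^bsub>G\<lparr>carrier := A\<rparr>\<^esub> B)"

definition finite_index_subgroups :: "('a, 'm) monoid_scheme \<Rightarrow> 'a set set" where
  "finite_index_subgroups G = {A. subgroup A G \<and> finite (rcosets\<^bsub>G\<^esub> A)}"

definition local_comm_graph :: "nat \<Rightarrow> ('a, 'm) monoid_scheme \<Rightarrow> 'a set pair_pre_digraph" where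
  "local_comm_graph p G =
     \<lparr> pverts = finite_index_subgroups G,
       parcs = {(A, B). A \<in> finite_index_subgroups G \<and> B \<in> finite_index_subgroups G \<and> A \<noteq> B \<and>
         (\<exists>k. subgroup_index G A (A \<inter> B) * subgroup_index G B (A \<inter> B) = p ^ k)} \<rparr>"

lemma pair_bidirected_local_comm_graph: "pair_bidirected_digraph (local_comm_graph p G)"
  by unfold_locales
    (auto simp: local_comm_graph_def symmetric_def sym_def arcs_ends_def arc_to_ends_def
      Int_commute mult.commute)

end

theory Submission
  imports Defs "HOL-Combinatorics.Orbits" "HOL-Number_Theory.Cong"
begin

text \<open>
The free group \<open>F\<close> is made to act on \<open>\<int>\<^sup>3\<close> by skew shifts
\<open>(i, z, y) \<mapsto> (i + k, z + b i, y + t i z)\<close>, where \<open>b\<close> is periodic modulo a prime \<open>r\<close> and \<open>t\<close> is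
periodic modulo \<open>r\<close> in its first and modulo \<open>p\<close> in its second argument. One free generator acts
by \<open>k = 1\<close> alone; the other combines an elementary \<open>b\<close> with an elementary \<open>t\<close>. Reduced modulo
\<open>(r, p, q)\<close> for a further prime \<open>q\<close>, the image of \<open>F\<close> is the iterated wreath product
\<open>C\<^sub>q \<wr> C\<^sub>p \<wr> C\<^sub>r\<close> in its imprimitive action. The vertices that matter are the subgroups
\<open>stab q w\<close> of those elements that preserve, modulo \<open>q\<close>, the graph \<open>y = w i z\<close> of a periodic
function \<open>w\<close>.

Such stabilizers are joined by edges as follows. Let \<open>\<psi>\<close> be a section, that is, a choice of one
point \<open>\<psi> i\<close> modulo \<open>p\<close> over each \<open>i\<close> modulo \<open>r\<close>, and let \<open>c\<close> be prime to \<open>q\<close>. Modulo \<open>q\<close>, the group \<open>stab q w\<close>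
permutes the \<open>p ^ r\<close> functions \<open>w + c \<cdot> 1\<^sub>\<psi>\<close> transitively, so the stabilizers of \<open>w\<close> and of \<open>w + c \<cdot> 1\<^sub>\<psi>\<close> meet in a
subgroup of index \<open>p ^ r\<close> in either (\<open>index_stab_add_section\<close>). Adding and subtracting such
indicators leads from the zero function to the staircase, which takes the value \<open>i\<close> at
\<open>(i, 1)\<close> for \<open>0 \<le> i < r\<close>; hence the stabilizers of both lie in one component.

The distance between them is large. Two facts survive along every path starting at
\<open>stab q 0\<close>. Each vertex is anchored: an element that fixes a point \<open>(i, z)\<close> modulo \<open>(r, p)\<close> does
not translate the fibre over it modulo \<open>q\<close>. And any two consecutive vertices \<open>A\<^sub>j\<close>,
\<open>A\<^sub>j\<^sub>+\<^sub>1\<close> share an element \<open>g\<^sub>j\<close> with \<open>k \<equiv> 1\<close> modulo \<open>r\<close>. Both follow from one observation about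
an index prime to \<open>l\<close> (\<open>conj_power_in_subgroup_coprime_index\<close>): every element of the large group
has a conjugate of a power, with exponent prime to \<open>l\<close>, in the small one. Now \<open>g\<^sub>j\<^sup>i\<close> carries the
fibre over \<open>0\<close> to the fibre over \<open>i\<close> by some rotation modulo \<open>p\<close>. If there are at most \<open>N + 1\<close>
vertices and \<open>r > p\<^bsup>N+1\<^esup>\<close>, the pigeonhole principle yields \<open>i < i' < r\<close> for which these rotations
agree for every \<open>j\<close>. Then all the elements \<open>g\<^sub>j\<^sup>i\<^sup>'\<^sup>-\<^sup>i\<close> carry the fibre over \<open>i\<close> to the fibre over
\<open>i'\<close> without rotation, and because neighbouring ones lie in a common anchored subgroup, they all
raise \<open>y\<close> by the same amounts modulo \<open>q\<close>. At the first vertex these amounts are \<open>0\<close>; at the last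
one they are the differences between the rows \<open>i'\<close> and \<open>i\<close> of the staircase. These differ when
\<open>q > r\<close>, so every path needs more than \<open>N\<close> edges.

Only \<open>q\<close> varies in the infinite family. For \<open>q \<noteq> q'\<close> the vertex \<open>stab q' 0\<close> contains the
\<open>p q'\<close>-th power of the second generator, which shows that it is not anchored modulo \<open>q\<close>. As
being anchored modulo \<open>q\<close> is constant on components, the components are distinct.
\<close>

section \<open>Indices and conjugates of powers\<close>

lemma bij_betw_image_same_kernel:
  assumes "\<And>x y. x \<in> A \<Longrightarrow> y \<in> A \<Longrightarrow> f x = f y \<longleftrightarrow> g x = g y"
  shows "\<exists>h. bij_betw h (f ` A) (g ` A)"
proof -
  have "bij_betw (\<lambda>c. g (inv_into A f c)) (f ` A) (g ` A)"
    unfolding bij_betw_def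
  proof
    show "inj_on (\<lambda>c. g (inv_into A f c)) (f ` A)"
      by (rule inj_onI) (metis assms f_inv_into_f inv_into_into)
    show "(\<lambda>c. g (inv_into A f c)) ` f ` A = g ` A"
      unfolding image_image
      by (rule image_cong[OF refl]) (metis assms f_inv_into_f imageI inv_into_into)
  qed
  then show ?thesis by blast
qed

context group
begin

lemma r_coset_eq_iff:
  assumes "subgroup B G" "x \<in> carrier G" "y \<in> carrier G"
  shows "B #> x = B #> y \<longleftrightarrow> x \<otimes> inv y \<in> B"
proof
  assume "B #> x = B #> y"
  then have "x \<in> B #> y" using rcos_self[OF assms(2,1)] by simp
  then show "x \<otimes> inv y \<in> B"
    using assms by (auto simp: r_coset_def m_assoc dest: subgroup.mem_carrier)
next
  assume "x \<otimes> inv y \<in> B"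
  moreover have "x = (x \<otimes> inv y) \<otimes> y" using assms by (simp add: m_assoc)
  ultimately have "x \<in> B #> y" unfolding r_coset_def by blast
  then show "B #> x = B #> y" using repr_independence[OF _ assms(3,1)] by simp
qed

lemma rcosets_carrier_update:
  "rcosets\<^bsub>G\<lparr>carrier := A\<rparr>\<^esub> B = (\<lambda>x. B #> x) ` A"
  by (auto simp: RCOSETS_def r_coset_def)

text \<open>
This is the way in which indices are computed below: \<open>f\<close> is typically the orbit map of a right
action, and then \<open>B\<close> is a stabilizer and the image is an orbit.
\<close>

lemma subgroup_index_eq_card_image:
  assumes "subgroup A G" "subgroup B G"
    and "\<And>x y. x \<in> A \<Longrightarrow> y \<in> A \<Longrightarrow> f x = f y \<longleftrightarrow> x \<otimes> inv y \<in> B"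
  shows "subgroup_index G A B = card (f ` A)"
proof -
  have "\<exists>h. bij_betw h ((\<lambda>x. B #> x) ` A) (f ` A)"
    by (rule bij_betw_image_same_kernel)
      (use assms r_coset_eq_iff subgroup.mem_carrier in metis)
  then show ?thesis
    unfolding subgroup_index_def rcosets_carrier_update by (auto dest: bij_betw_same_card)
qed

lemma finite_rcosets_if_finite_image:
  assumes "subgroup B G" "finite (f ` carrier G)"
    and "\<And>x y. x \<in> carrier G \<Longrightarrow> y \<in> carrier G \<Longrightarrow> f x = f y \<longleftrightarrow> x \<otimes> inv y \<in> B"
  shows "finite (rcosets B)"
proof -
  have "\<exists>h. bij_betw h ((\<lambda>x. B #> x) ` carrier G) (f ` carrier G)"
    by (rule bij_betw_image_same_kernel)
      (use assms r_coset_eq_iff in metis)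
  moreover have "rcosets B = (\<lambda>x. B #> x) ` carrier G" by (auto simp: RCOSETS_def)
  ultimately show ?thesis using assms(2) by (auto dest: bij_betw_finite)
qed

text \<open>
The powers of \<open>g\<close> act on the cosets of \<open>B\<close> in \<open>A\<close>. The orbit sizes add up to the index, so
one of them is prime to \<open>l\<close>; let this be the orbit of \<open>B y\<close>, of size \<open>j\<close>. Then \<open>g\<^sup>j\<close> fixes the
coset \<open>B y\<close>. The subgroups here are infinite, and \<open>B\<close> need not be normal, so neither orders nor
quotients are at hand.
\<close>

lemma conj_power_in_subgroup_coprime_index:
  fixes l :: nat
  assumes A: "subgroup A G" and B: "subgroup B G" and g: "g \<in> A"
    and l: "\<not> l dvd subgroup_index G A B"
  obtains y j where "y \<in> A" "\<not> l dvd (j :: nat)" "y \<otimes> g [^] j \<otimes> inv y \<in> B"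
proof -
  define R where "R = (\<lambda>x. B #> x) ` A"
  have card: "card R = subgroup_index G A B"
    by (simp add: R_def subgroup_index_def rcosets_carrier_update)
  then have fin: "finite R" using l by (metis card.infinite dvd_0_right)
  have AG: "\<And>x. x \<in> A \<Longrightarrow> x \<in> carrier G" and BG: "B \<subseteq> carrier G"
    using A B by (auto dest: subgroup.mem_carrier)
  \<comment> \<open>Right multiplication by \<open>g\<close>, extended by the identity to a permutation of the whole type.\<close>
  define \<pi> where "\<pi> c = (if c \<in> R then c #> g else c)" for c
  have step: "\<pi> (B #> x) = B #> (x \<otimes> g)" if "x \<in> A" for x
    using that AG g BG by (simp add: \<pi>_def R_def coset_mult_assoc)
  have image: "\<pi> ` R = R"
  proof
    show "\<pi> ` R \<subseteq> R"
      using step subgroup.m_closed[OF A _ g] by (auto simp: R_def)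
    show "R \<subseteq> \<pi> ` R"
    proof
      fix c assume "c \<in> R"
      then obtain x where x: "x \<in> A" "c = B #> x" by (auto simp: R_def)
      have xg: "x \<otimes> inv g \<in> A" using x g A by (simp add: subgroup.m_closed subgroup.m_inv_closed)
      have "\<pi> (B #> (x \<otimes> inv g)) = c"
        using step[OF xg] x g AG by (simp add: m_assoc)
      then show "c \<in> \<pi> ` R" using xg by (auto simp: R_def)
    qed
  qed
  have perm: "permutation \<pi>"
  proof -
    have "bij_betw \<pi> R R"
      using image fin by (simp add: bij_betw_def eq_card_imp_inj_on)
    then have "\<pi> permutes R"
      by (rule bij_imp_permutes) (simp add: \<pi>_def)
    then show ?thesis using fin by (auto simp: permutation_permutes)
  qed
  have funpow: "(\<pi> ^^ n) (B #> x) = B #> (x \<otimes> g [^] n)" if "x \<in> A" for x n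
  proof (induction n)
    case 0
    then show ?case using that AG by simp
  next
    case (Suc n)
    have "x \<otimes> g [^] n \<in> A"
      by (induction n) (use that g A AG in \<open>simp_all add: subgroup.m_closed m_assoc[symmetric]\<close>)
    then show ?case using Suc step that g AG by (simp add: m_assoc)
  qed
  have orbit_sub: "orbit \<pi> c \<subseteq> R" if "c \<in> R" for c
  proof
    fix d assume "d \<in> orbit \<pi> c"
    then show "d \<in> R" using that image by induction auto
  qed
  have union: "\<Union> (orbit \<pi> ` R) = R"
    using orbit_sub permutation_self_in_orbit[OF perm] by blast
  have "\<exists>c\<in>R. \<not> l dvd card (orbit \<pi> c)"
  proof (rule ccontr)
    assume "\<not> ?thesis"
    moreover have "orbit \<pi> c \<inter> orbit \<pi> d = {}" if "orbit \<pi> c \<noteq> orbit \<pi> d" for c d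
    proof (rule ccontr)
      assume "orbit \<pi> c \<inter> orbit \<pi> d \<noteq> {}"
      then obtain e where "e \<in> orbit \<pi> c" "e \<in> orbit \<pi> d" by blast
      then have "orbit \<pi> c = orbit \<pi> e" "orbit \<pi> d = orbit \<pi> e"
        by (meson orbit_swap orbit_trans permutation_self_in_orbit[OF perm] subsetI subset_antisym)+
      then show False using that by simp
    qed
    ultimately have "l dvd card (\<Union> (orbit \<pi> ` R))"
      by (intro dvd_partition) (use union fin in auto)
    then show False using l card union by simp
  qed
  then obtain c where c: "c \<in> R" "\<not> l dvd card (orbit \<pi> c)" by blast
  define j where "j = funpow_dist1 \<pi> c c"
  have self: "c \<in> orbit \<pi> c" by (rule permutation_self_in_orbit[OF perm])
  have "card (orbit \<pi> c) = j"
    unfolding orbit_conv_funpow_dist1[OF self] j_def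
    by (subst card_image[OF inj_on_funpow_dist1[OF self]]) simp
  moreover have "(\<pi> ^^ j) c = c" unfolding j_def by (rule funpow_dist1_prop[OF self])
  moreover obtain y where y: "y \<in> A" "c = B #> y" using c(1) by (auto simp: R_def)
  ultimately have "B #> (y \<otimes> g [^] j) = B #> y" using funpow[of y j] by simp
  then have "y \<otimes> g [^] j \<otimes> inv y \<in> B"
    using r_coset_eq_iff[OF B] y(1) g AG by simp
  then show thesis using that y(1) c(2) \<open>card (orbit \<pi> c) = j\<close> by blast
qed

end

section \<open>Groups acting by skew shifts\<close>

text \<open>
An element \<open>x\<close> stands for the permutation
\<open>(i, z, y) \<mapsto> (i + shift x, z + turn x i, y + lift x i z)\<close> of \<open>\<int>\<^sup>3\<close>; the multiplication rules say
that \<open>x \<otimes> y\<close> applies \<open>y\<close> first. The integers are not reduced modulo \<open>r\<close>, \<open>p\<close> or \<open>q\<close>, which keeps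
these rules free of case distinctions and leaves \<open>q\<close> free to vary.
\<close>

locale skew_shift_action = group G for G :: "('a, 'm) monoid_scheme" (structure) +
  fixes shift :: "'a \<Rightarrow> int" and turn :: "'a \<Rightarrow> int \<Rightarrow> int" and lift :: "'a \<Rightarrow> int \<Rightarrow> int \<Rightarrow> int"
    and r p :: nat
  assumes shift_mult: "\<lbrakk>x \<in> carrier G; y \<in> carrier G\<rbrakk> \<Longrightarrow> shift (x \<otimes> y) = shift x + shift y"
    and turn_mult: "\<lbrakk>x \<in> carrier G; y \<in> carrier G\<rbrakk> \<Longrightarrow>
          turn (x \<otimes> y) i = turn y i + turn x (i + shift y)"
    and lift_mult: "\<lbrakk>x \<in> carrier G; y \<in> carrier G\<rbrakk> \<Longrightarrow>
          lift (x \<otimes> y) i z = lift y i z + lift x (i + shift y) (z + turn y i)"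
    and turn_periodic: "\<lbrakk>x \<in> carrier G; [i = j] (mod int r)\<rbrakk> \<Longrightarrow> turn x i = turn x j"
    and lift_periodic: "\<lbrakk>x \<in> carrier G; [i = j] (mod int r); [z = z'] (mod int p)\<rbrakk> \<Longrightarrow>
          lift x i z = lift x j z'"
    and prime_r: "prime r" and prime_p: "prime p" and r_neq_p: "r \<noteq> p"
begin

lemma shift_one [simp]: "shift \<one> = 0"
  and turn_one [simp]: "turn \<one> i = 0"
  and lift_one [simp]: "lift \<one> i z = 0"
proof -
  show shift: "shift \<one> = 0" using shift_mult[of \<one> \<one>] by simp
  show turn: "turn \<one> i = 0" for i using turn_mult[of \<one> \<one> i] shift by simp
  show "lift \<one> i z = 0" using lift_mult[of \<one> \<one> i z] shift turn by simp
qed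

lemma shift_inv: "x \<in> carrier G \<Longrightarrow> shift (inv x) = - shift x"
  using shift_mult[of "inv x" x] by simp

lemma turn_inv: "x \<in> carrier G \<Longrightarrow> turn (inv x) (i + shift x) = - turn x i"
  using turn_mult[of "inv x" x i] by simp

lemma lift_inv: "x \<in> carrier G \<Longrightarrow> lift (inv x) (i + shift x) (z + turn x i) = - lift x i z"
  using lift_mult[of "inv x" x i z] by simp

lemma shift_pow: "x \<in> carrier G \<Longrightarrow> shift (x [^] (n::nat)) = int n * shift x"
  by (induction n) (simp_all add: shift_mult algebra_simps)

text \<open>
If \<open>x\<close> fixes \<open>(i, z)\<close> modulo \<open>(r, p)\<close>, then by periodicity each further factor \<open>x\<close> meets the
same values of \<open>turn\<close> and \<open>lift\<close> again.
\<close>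

lemma fixing_pow:
  assumes "x \<in> carrier G" "int r dvd shift x" "int p dvd turn x i"
  shows "turn (x [^] (n::nat)) i = int n * turn x i"
    and "lift (x [^] n) i z = int n * lift x i z"
proof -
  have i: "[i + shift x = i] (mod int r)" and z: "[z + turn x i = z] (mod int p)" for z
    using assms by (simp_all add: cong_iff_dvd_diff)
  show "turn (x [^] n) i = int n * turn x i"
  proof (induction n)
    case (Suc n)
    then show ?case
      using assms(1) turn_periodic[OF nat_pow_closed[OF assms(1)] i]
      by (simp add: turn_mult algebra_simps)
  qed simp
  show "lift (x [^] n) i z = int n * lift x i z"
  proof (induction n)
    case (Suc n)
    then show ?case
      using assms(1) lift_periodic[OF nat_pow_closed[OF assms(1)] i z]
      by (simp add: lift_mult algebra_simps)
  qed simp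
qed

lemma shift_conj:
  assumes "x \<in> carrier G" "y \<in> carrier G"
  shows "shift (y \<otimes> x \<otimes> inv y) = shift x"
  using assms by (simp add: shift_mult shift_inv)

lemma turn_conj:
  assumes "x \<in> carrier G" "y \<in> carrier G" "int r dvd shift x"
  shows "turn (y \<otimes> x \<otimes> inv y) (i + shift y) = turn x i"
proof -
  have "[i + shift x = i] (mod int r)" using assms by (simp add: cong_iff_dvd_diff)
  then show ?thesis
    using assms turn_periodic[of y "i + shift x" i]
    by (simp add: turn_mult shift_mult turn_inv shift_inv)
qed

lemma lift_conj:
  assumes "x \<in> carrier G" "y \<in> carrier G" "int r dvd shift x"
  shows "lift (y \<otimes> x \<otimes> inv y) (i + shift y) (z + turn y i) =
         lift x i z + (lift y i (z + turn x i) - lift y i z)"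
proof -
  have "[i + shift x = i] (mod int r)" using assms by (simp add: cong_iff_dvd_diff)
  then show ?thesis
    using assms lift_periodic[of y "i + shift x" i "z + turn x i" "z + turn x i"]
    by (simp add: turn_mult lift_mult shift_mult turn_inv lift_inv shift_inv)
qed

text \<open>
Translations of a fibre commute, so conjugation moves the fibre but does not change the amount
by which it is translated.
\<close>

lemma lift_conj_fixing:
  assumes "x \<in> carrier G" "y \<in> carrier G" "int r dvd shift x" "int p dvd turn x i"
  shows "lift (y \<otimes> x \<otimes> inv y) (i + shift y) (z + turn y i) = lift x i z"
  using lift_conj[OF assms(1-3)] lift_periodic[OF assms(2), of i i "z + turn x i" z] assms(4)
  by (simp add: cong_iff_dvd_diff)

section \<open>Stabilizers of functions modulo a prime\<close>

text \<open>
The graph of \<open>pull g w\<close> is the preimage under \<open>g\<close> of the graph \<open>y = w i z\<close>. Preimages form a right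
action, and so match the right cosets used for indices.
\<close>

definition pull :: "'a \<Rightarrow> (int \<Rightarrow> int \<Rightarrow> int) \<Rightarrow> int \<Rightarrow> int \<Rightarrow> int" where
  "pull g w i z = w (i + shift g) (z + turn g i) - lift g i z"

definition periodic :: "(int \<Rightarrow> int \<Rightarrow> int) \<Rightarrow> bool" where
  "periodic w \<longleftrightarrow> (\<forall>i j z z'. [i = j] (mod int r) \<longrightarrow> [z = z'] (mod int p) \<longrightarrow> w i z = w j z')"

definition stab :: "nat \<Rightarrow> (int \<Rightarrow> int \<Rightarrow> int) \<Rightarrow> 'a set" where
  "stab q w = {g \<in> carrier G. \<forall>i z. [pull g w i z = w i z] (mod int q)}"

lemma pull_one: "pull \<one> w = w"
  by (intro ext) (simp add: pull_def)

lemma pull_mult: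
  "\<lbrakk>x \<in> carrier G; y \<in> carrier G\<rbrakk> \<Longrightarrow> pull (x \<otimes> y) w = pull y (pull x w)"
  by (intro ext) (simp add: pull_def shift_mult turn_mult lift_mult algebra_simps)

lemma pull_cong:
  assumes "\<And>i z. [u i z = v i z] (mod int q)"
  shows "[pull g u i z = pull g v i z] (mod int q)"
  unfolding pull_def by (rule cong_diff[OF assms cong_refl])

lemma mult_inv_mem_stab_iff:
  assumes "x \<in> carrier G" "y \<in> carrier G"
  shows "x \<otimes> inv y \<in> stab q w \<longleftrightarrow> (\<forall>i z. [pull x w i z = pull y w i z] (mod int q))"
proof
  assume "x \<otimes> inv y \<in> stab q w"
  then have "[pull (x \<otimes> inv y) w i z = w i z] (mod int q)" for i z
    by (simp add: stab_def)
  then have "[pull y (pull (x \<otimes> inv y) w) i z = pull y w i z] (mod int q)" for i z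
    by (rule pull_cong)
  moreover have "pull y (pull (x \<otimes> inv y) w) = pull x w"
    using assms by (simp add: pull_mult[symmetric] m_assoc)
  ultimately show "\<forall>i z. [pull x w i z = pull y w i z] (mod int q)" by simp
next
  assume "\<forall>i z. [pull x w i z = pull y w i z] (mod int q)"
  then have "[pull (inv y) (pull x w) i z = pull (inv y) (pull y w) i z] (mod int q)" for i z
    by (intro pull_cong) simp
  then show "x \<otimes> inv y \<in> stab q w"
    using assms by (simp add: stab_def pull_mult[symmetric] pull_one)
qed

lemma stab_carrier: "stab q w \<subseteq> carrier G"
  by (auto simp: stab_def)

lemma subgroup_stab: "subgroup (stab q w) G"
proof (rule subgroupI)
  show "stab q w \<subseteq> carrier G" by (rule stab_carrier)
  show "stab q w \<noteq> {}" by (auto simp: stab_def pull_one intro!: exI[of _ \<one>])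
next
  fix x assume x: "x \<in> stab q w"
  then show "inv x \<in> stab q w"
    using mult_inv_mem_stab_iff[of \<one> x q w] by (auto simp: stab_def pull_one cong_sym)
next
  fix x y assume xy: "x \<in> stab q w" "y \<in> stab q w"
  have "[pull y (pull x w) i z = w i z] (mod int q)" for i z
  proof (rule cong_trans)
    show "[pull y (pull x w) i z = pull y w i z] (mod int q)"
      by (rule pull_cong) (use xy in \<open>simp add: stab_def\<close>)
    show "[pull y w i z = w i z] (mod int q)" using xy by (simp add: stab_def)
  qed
  then show "x \<otimes> y \<in> stab q w"
    using xy by (simp add: stab_def pull_mult)
qed

lemma r_pos: "0 < r" and p_pos: "0 < p"
  using prime_r prime_p by (simp_all add: prime_gt_0_nat)

lemma periodic_cong_iff:
  assumes "periodic u" "periodic v"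
  shows "(\<forall>i z. [u i z = v i z] (mod int q)) \<longleftrightarrow>
     restrict (\<lambda>(i, z). u i z mod int q) ({0..<int r} \<times> {0..<int p}) =
     restrict (\<lambda>(i, z). v i z mod int q) ({0..<int r} \<times> {0..<int p})" (is "?L \<longleftrightarrow> ?l = ?r")
proof
  assume ?L
  then show "?l = ?r" by (auto simp: restrict_def cong_def fun_eq_iff)
next
  assume eq: "?l = ?r"
  show ?L
  proof (intro allI)
    fix i z
    define i' z' where "i' = i mod int r" and "z' = z mod int p"
    have *: "[i = i'] (mod int r)" "[z = z'] (mod int p)" by (simp_all add: i'_def z'_def cong_def)
    have "(i', z') \<in> {0..<int r} \<times> {0..<int p}" using r_pos p_pos by (simp add: i'_def z'_def)
    then have "u i' z' mod int q = v i' z' mod int q" using fun_cong[OF eq, of "(i', z')"] by simp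
    moreover have "u i z = u i' z'" "v i z = v i' z'"
      using assms * unfolding periodic_def by blast+
    ultimately show "[u i z = v i z] (mod int q)" by (simp add: cong_def)
  qed
qed

lemma periodic_pull:
  assumes "g \<in> carrier G" "periodic w"
  shows "periodic (pull g w)"
  unfolding periodic_def
proof (intro allI impI)
  fix i j z z' assume ij: "[i = j] (mod int r)" "[z = z'] (mod int p)"
  have "turn g i = turn g j" "lift g i z = lift g j z'"
    using turn_periodic lift_periodic ij assms(1) by blast+
  moreover have "w (i + shift g) (z + turn g j) = w (j + shift g) (z' + turn g j)"
    using assms(2) cong_add[OF ij(1) cong_refl] cong_add[OF ij(2) cong_refl]
    unfolding periodic_def by blast
  ultimately show "pull g w i z = pull g w j z'" by (simp add: pull_def)
qed

text \<open>
Modulo \<open>q\<close>, a periodic function is determined by its reduced values on an \<open>r \<times> p\<close> box. This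
leaves finitely many functions in the orbit of \<open>w\<close>.
\<close>

lemma stab_finite_index:
  assumes "periodic w" "q > 0"
  shows "stab q w \<in> finite_index_subgroups G"
proof -
  let ?box = "{0..<int r} \<times> {0..<int p}"
  let ?f = "\<lambda>x. restrict (\<lambda>(i, z). pull x w i z mod int q) ?box"
  have "?f ` carrier G \<subseteq> ?box \<rightarrow>\<^sub>E {0..<int q}"
    using assms(2) by (auto simp: restrict_def split: if_splits)
  then have fin: "finite (?f ` carrier G)"
    by (rule finite_subset) (intro finite_PiE, auto)
  have "?f x = ?f y \<longleftrightarrow> x \<otimes> inv y \<in> stab q w" if "x \<in> carrier G" "y \<in> carrier G" for x y
    unfolding mult_inv_mem_stab_iff[OF that]
    using periodic_cong_iff[OF periodic_pull[OF that(1) assms(1)] periodic_pull[OF that(2) assms(1)]]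
    by simp
  then have "finite (rcosets (stab q w))"
    by (rule finite_rcosets_if_finite_image[OF subgroup_stab fin])
  then show ?thesis by (simp add: finite_index_subgroups_def subgroup_stab)
qed

section \<open>Adding the indicator of a section\<close>

definition periodic_section :: "(int \<Rightarrow> int) \<Rightarrow> bool" where
  "periodic_section \<psi> \<longleftrightarrow> (\<forall>i j. [i = j] (mod int r) \<longrightarrow> \<psi> i = \<psi> j)"

definition pull_section :: "'a \<Rightarrow> (int \<Rightarrow> int) \<Rightarrow> int \<Rightarrow> int" where
  "pull_section g \<psi> i = \<psi> (i + shift g) - turn g i"

definition section_indicator :: "(int \<Rightarrow> int) \<Rightarrow> int \<Rightarrow> int \<Rightarrow> int" where
  "section_indicator \<psi> i z = of_bool [z = \<psi> i] (mod int p)"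

definition add_section :: "int \<Rightarrow> (int \<Rightarrow> int) \<Rightarrow> (int \<Rightarrow> int \<Rightarrow> int) \<Rightarrow> int \<Rightarrow> int \<Rightarrow> int" where
  "add_section c \<psi> w i z = w i z + c * section_indicator \<psi> i z"

lemma pull_add_section:
  "pull g (add_section c \<psi> w) = add_section c (pull_section g \<psi>) (pull g w)"
proof (intro ext)
  fix i z
  have "[z + turn g i = \<psi> (i + shift g)] (mod int p) \<longleftrightarrow>
        [z = \<psi> (i + shift g) - turn g i] (mod int p)"
    by (simp add: cong_iff_dvd_diff algebra_simps)
  then show "pull g (add_section c \<psi> w) i z = add_section c (pull_section g \<psi>) (pull g w) i z"
    by (simp add: pull_def add_section_def section_indicator_def pull_section_def)
qed

lemma periodic_add_section:
  assumes "periodic w" "periodic_section \<psi>"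
  shows "periodic (add_section c \<psi> w)"
  unfolding periodic_def
proof (intro allI impI)
  fix i j z z' assume ij: "[i = j] (mod int r)" "[z = z'] (mod int p)"
  have "w i z = w j z'" "\<psi> i = \<psi> j"
    using assms ij unfolding periodic_def periodic_section_def by blast+
  moreover have "[z = \<psi> j] (mod int p) \<longleftrightarrow> [z' = \<psi> j] (mod int p)"
    using ij by (simp add: cong_def)
  ultimately show "add_section c \<psi> w i z = add_section c \<psi> w j z'"
    by (simp add: add_section_def section_indicator_def)
qed

text \<open>
A nonzero multiple of the indicator of a section still determines the section.
\<close>

lemma section_indicator_cong_iff:
  assumes "\<not> int q dvd c"
  shows "(\<forall>i z. [c * section_indicator \<phi> i z = c * section_indicator \<psi> i z] (mod int q)) \<longleftrightarrow>
         (\<forall>i. [\<phi> i = \<psi> i] (mod int p))"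
proof
  assume *: "\<forall>i z. [c * section_indicator \<phi> i z = c * section_indicator \<psi> i z] (mod int q)"
  show "\<forall>i. [\<phi> i = \<psi> i] (mod int p)"
  proof (rule allI, rule ccontr)
    fix i assume "\<not> [\<phi> i = \<psi> i] (mod int p)"
    then have "[c = 0] (mod int q)" using *[rule_format, of i "\<phi> i"] by (simp add: section_indicator_def)
    then show False using assms by (simp add: cong_0_iff)
  qed
next
  assume "\<forall>i. [\<phi> i = \<psi> i] (mod int p)"
  then have "[z = \<phi> i] (mod int p) \<longleftrightarrow> [z = \<psi> i] (mod int p)" for i z
    by (simp add: cong_def)
  then have "section_indicator \<phi> i z = section_indicator \<psi> i z" for i z
    by (simp add: section_indicator_def)
  then show "\<forall>i z. [c * section_indicator \<phi> i z = c * section_indicator \<psi> i z] (mod int q)" by simp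
qed

text \<open>
The pullback acts on \<open>w + c \<cdot> 1\<^sub>\<psi>\<close> through both summands. For elements of \<open>stab q w\<close> the first
summand does not move, so only the effect on the section \<open>\<psi>\<close> counts.
\<close>

lemma mult_inv_mem_stab_add_section_iff:
  assumes q: "\<not> int q dvd c" and xy: "x \<in> stab q w" "y \<in> stab q w"
  shows "x \<otimes> inv y \<in> stab q (add_section c \<psi> w) \<longleftrightarrow>
         (\<forall>i. [pull_section x \<psi> i = pull_section y \<psi> i] (mod int p))"
proof -
  have G: "x \<in> carrier G" "y \<in> carrier G" using xy stab_carrier by auto
  have "[pull x w i z = pull y w i z] (mod int q)" for i z
  proof (rule cong_trans)
    show "[pull x w i z = w i z] (mod int q)" using xy by (simp add: stab_def)
    show "[w i z = pull y w i z] (mod int q)" using xy by (simp add: stab_def cong_sym)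
  qed
  then have dvd: "int q dvd pull x w i z - pull y w i z" for i z
    by (simp add: cong_iff_dvd_diff)
  have "[pull x w i z + s = pull y w i z + s'] (mod int q) \<longleftrightarrow> [s = s'] (mod int q)" for i z s s'
  proof -
    have "pull x w i z + s - (pull y w i z + s') = (pull x w i z - pull y w i z) + (s - s')" by simp
    then show ?thesis unfolding cong_iff_dvd_diff using dvd_add_right_iff[OF dvd] by metis
  qed
  then show ?thesis
    unfolding mult_inv_mem_stab_iff[OF G] pull_add_section add_section_def
    using section_indicator_cong_iff[OF q] by simp
qed

end

section \<open>Prescribing rotations and lifts\<close>

text \<open>
The rotation in \<open>\<beta>\<close> lives over \<open>i \<equiv> 0\<close> and its lift over \<open>i \<equiv> 1\<close>. These two parts therefore
commute, and since \<open>p\<close> and \<open>q\<close> are coprime, powers of \<open>\<beta>\<close> separate them. That is how two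
generators suffice.
\<close>

locale generated_skew_shift_action = skew_shift_action +
  fixes \<alpha> \<beta> :: 'a
  assumes alpha: "\<alpha> \<in> carrier G" "shift \<alpha> = 1" "turn \<alpha> i = 0" "lift \<alpha> i z = 0"
    and beta: "\<beta> \<in> carrier G" "shift \<beta> = 0" "turn \<beta> i = of_bool (int r dvd i)"
      "lift \<beta> i z = of_bool ([i = 1] (mod int r) \<and> int p dvd z)"
begin

text \<open>
The elements with \<open>shift g = 0\<close> map to the base group of the wreath product over \<open>C\<^sub>r\<close>, of which
\<open>b\<close> and \<open>t\<close> are the coordinates once they are read modulo \<open>p\<close> and \<open>q\<close>.
\<close>

definition realizes :: "nat \<Rightarrow> 'a \<Rightarrow> (int \<Rightarrow> int) \<Rightarrow> (int \<Rightarrow> int \<Rightarrow> int) \<Rightarrow> bool" where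
  "realizes q g b t \<longleftrightarrow> g \<in> carrier G \<and> shift g = 0 \<and>
     (\<forall>i. [turn g i = b i] (mod int p)) \<and> (\<forall>i z. [lift g i z = t i z] (mod int q))"

lemma realizes_one: "realizes q \<one> (\<lambda>i. 0) (\<lambda>i z. 0)"
  by (simp add: realizes_def)

text \<open>
In general the rotation by \<open>y\<close> distorts the lift by \<open>x\<close>. The side condition excludes this: either
\<open>y\<close> does not rotate, or there is no lift to distort.
\<close>

lemma realizes_mult:
  assumes x: "realizes q x b t" and y: "realizes q y b' t'"
    and "b' = (\<lambda>i. 0) \<or> t = (\<lambda>i z. 0)"
  shows "realizes q (x \<otimes> y) (\<lambda>i. b i + b' i) (\<lambda>i z. t i z + t' i z)"
proof -
  have G: "x \<in> carrier G" "y \<in> carrier G" "shift x = 0" "shift y = 0"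
    using x y by (simp_all add: realizes_def)
  have tx: "[lift x i z = t i z] (mod int q)" for i z using x by (simp add: realizes_def)
  have "[lift x i (z + turn y i) = t i z] (mod int q)" for i z
  proof (cases "b' = (\<lambda>i. 0)")
    case True
    then have "[z + turn y i = z] (mod int p)"
      using y by (simp add: realizes_def cong_0_iff cong_iff_dvd_diff)
    then have "lift x i (z + turn y i) = lift x i z"
      by (rule lift_periodic[OF G(1) cong_refl])
    then show ?thesis using tx by simp
  next
    case False
    then show ?thesis using tx[of i "z + turn y i"] assms(3) by auto
  qed
  then have "[lift y i z + lift x i (z + turn y i) = t' i z + t i z] (mod int q)" for i z
    using y by (intro cong_add) (simp_all add: realizes_def)
  moreover have "[turn y i + turn x i = b' i + b i] (mod int p)" for i
    using x y by (intro cong_add) (simp_all add: realizes_def)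
  ultimately show ?thesis
    using G by (simp add: realizes_def shift_mult turn_mult lift_mult add.commute)
qed

lemma realizes_sum_turn:
  assumes "finite S" "\<And>s. s \<in> S \<Longrightarrow> \<exists>g. realizes q g (b s) (\<lambda>i z. 0)"
  shows "\<exists>g. realizes q g (\<lambda>i. \<Sum>s\<in>S. b s i) (\<lambda>i z. 0)"
  using assms
proof (induction S rule: finite_induct)
  case empty
  then show ?case using realizes_one by auto
next
  case (insert s S)
  then obtain g h where "realizes q g (b s) (\<lambda>i z. 0)"
    "realizes q h (\<lambda>i. \<Sum>s\<in>S. b s i) (\<lambda>i z. 0)" by blast
  from realizes_mult[OF this] insert.hyps show ?case by auto
qed

lemma realizes_sum_lift:
  assumes "finite S" "\<And>s. s \<in> S \<Longrightarrow> \<exists>g. realizes q g (\<lambda>i. 0) (t s)"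
  shows "\<exists>g. realizes q g (\<lambda>i. 0) (\<lambda>i z. \<Sum>s\<in>S. t s i z)"
  using assms
proof (induction S rule: finite_induct)
  case empty
  then show ?case using realizes_one by auto
next
  case (insert s S)
  then obtain g h where "realizes q g (\<lambda>i. 0) (t s)"
    "realizes q h (\<lambda>i. 0) (\<lambda>i z. \<Sum>s\<in>S. t s i z)" by blast
  from realizes_mult[OF this] insert.hyps show ?case by auto
qed

lemma realizes_conj:
  assumes x: "realizes q x b t" and y: "y \<in> carrier G"
    and "b = (\<lambda>i. 0) \<or> (\<forall>i z. lift y i z = 0)"
  shows "realizes q (y \<otimes> x \<otimes> inv y) (\<lambda>i. b (i - shift y))
           (\<lambda>i z. t (i - shift y) (z - turn y (i - shift y)))"
proof -
  have G: "x \<in> carrier G" "shift x = 0" using x by (simp_all add: realizes_def)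
  then have x0: "int r dvd shift x" by simp
  have "lift y i (z + turn x i) = lift y i z" for i z
  proof (cases "b = (\<lambda>i. 0)")
    case True
    then have "[z + turn x i = z] (mod int p)"
      using x by (simp add: realizes_def cong_0_iff cong_iff_dvd_diff)
    then show ?thesis by (rule lift_periodic[OF y cong_refl])
  next
    case False
    then show ?thesis using assms(3) by auto
  qed
  then have "lift (y \<otimes> x \<otimes> inv y) i z = lift x (i - shift y) (z - turn y (i - shift y))" for i z
    using lift_conj[OF G(1) y x0, of "i - shift y" "z - turn y (i - shift y)"] by simp
  moreover have "turn (y \<otimes> x \<otimes> inv y) i = turn x (i - shift y)" for i
    using turn_conj[OF G(1) y x0, of "i - shift y"] by simp
  ultimately show ?thesis
    using x y by (simp add: realizes_def shift_conj)
qed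

lemma r_ge_2: "r \<ge> 2" using prime_r by (rule prime_ge_2_nat)

lemma beta_pow:
  "shift (\<beta> [^] (n::nat)) = 0"
  "turn (\<beta> [^] n) i = int n * of_bool (int r dvd i)"
  "lift (\<beta> [^] n) i z = int n * of_bool ([i = 1] (mod int r) \<and> int p dvd z)"
proof -
  show "shift (\<beta> [^] n) = 0" by (simp add: shift_pow beta)
  show "turn (\<beta> [^] n) i = int n * of_bool (int r dvd i)"
    by (induction n) (simp_all add: turn_mult beta algebra_simps)
  show "lift (\<beta> [^] n) i z = int n * of_bool ([i = 1] (mod int r) \<and> int p dvd z)"
  proof (induction n arbitrary: z)
    case (Suc n)
    have "\<not> int r dvd i" if "[i = 1] (mod int r)"
      using that r_ge_2 by (simp add: cong_def dvd_eq_mod_eq_0)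
    then show ?case by (auto simp: lift_mult beta Suc algebra_simps)
  qed simp
qed

lemma alpha_pow:
  "shift (\<alpha> [^] (n::nat)) = int n"
  "turn (\<alpha> [^] n) i = 0"
  "lift (\<alpha> [^] n) i z = 0"
proof -
  show "shift (\<alpha> [^] n) = int n" by (simp add: shift_pow alpha)
  show turn: "turn (\<alpha> [^] n) i = 0" for i
    by (induction n arbitrary: i) (simp_all add: turn_mult alpha)
  show "lift (\<alpha> [^] n) i z = 0"
    by (induction n arbitrary: i z) (simp_all add: lift_mult alpha)
qed

text \<open>
A power of \<open>\<beta>\<close> rotates the fibre over \<open>0\<close> as prescribed without lifting anything modulo \<open>q\<close>.
Its conjugates by powers of \<open>\<alpha>\<close> do the same over the other \<open>i\<close>, and \<open>b\<close> is the sum of its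
restrictions to single residue classes.
\<close>

lemma realizes_turn:
  assumes "coprime p q" and b: "periodic_section b"
  shows "\<exists>g. realizes q g b (\<lambda>i z. 0)"
proof -
  have "\<exists>g. realizes q g (\<lambda>i. b s * of_bool (int r dvd i - s)) (\<lambda>i z. 0)"
    if s: "s \<in> {0..<int r}" for s
  proof -
    obtain m where m: "[m = nat (b s mod int p)] (mod p)" "[m = 0] (mod q)"
      using binary_chinese_remainder_nat[OF assms(1)] by blast
    have mp: "[int m = b s] (mod int p)"
    proof -
      have "[int m = int (nat (b s mod int p))] (mod int p)"
        using m(1) by (simp only: cong_int_iff)
      then show ?thesis using p_pos by (simp add: cong_def)
    qed
    have mq: "[int m = 0] (mod int q)"
      using m(2) by (metis cong_int_iff of_nat_0)
    have "realizes q (\<beta> [^] m) (\<lambda>i. b s * of_bool (int r dvd i)) (\<lambda>i z. 0)"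
      unfolding realizes_def beta_pow using mp mq
      by (auto intro: cong_scalar_right simp: beta cong_0_iff)
    from realizes_conj[OF this, of "\<alpha> [^] nat s"] s
    show ?thesis by (auto simp: alpha_pow alpha)
  qed
  then have "\<exists>g. realizes q g (\<lambda>i. \<Sum>s\<in>{0..<int r}. b s * of_bool (int r dvd i - s)) (\<lambda>i z. 0)"
    by (intro realizes_sum_turn) auto
  moreover have "(\<Sum>s\<in>{0..<int r}. b s * of_bool (int r dvd i - s)) = b i" for i
  proof -
    have "int r dvd i - s \<longleftrightarrow> s = i mod int r" if "s \<in> {0..<int r}" for s
      using that by (auto simp: mod_eq_dvd_iff[symmetric])
    then have "(\<Sum>s\<in>{0..<int r}. b s * of_bool (int r dvd i - s)) =
               (\<Sum>s\<in>{0..<int r}. if s = i mod int r then b s else 0)"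
      by (intro sum.cong) auto
    also have "\<dots> = b (i mod int r)" using r_pos by simp
    also have "\<dots> = b i" 
    proof -
      have "[i mod int r = i] (mod int r)" by (simp add: cong_def)
      then show ?thesis using b unfolding periodic_section_def by blast
    qed
    finally show ?thesis .
  qed
  ultimately show ?thesis by simp
qed

text \<open>
A power of \<open>\<beta>\<close> lifts at the single point \<open>(1, 0)\<close> as prescribed without rotating anything modulo
\<open>p\<close>. Conjugation by an element that moves \<open>(1, 0)\<close> to \<open>(i0, z0)\<close> gives every other point, and
\<open>t\<close> is the sum of its restrictions to single points.
\<close>

lemma realizes_lift:
  assumes "coprime p q" "q > 0" and t: "periodic t"
  shows "\<exists>g. realizes q g (\<lambda>i. 0) t"
proof -
  let ?box = "{0..<int r} \<times> {0..<int p}"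
  let ?\<delta> = "\<lambda>s i z. t (fst s) (snd s) * of_bool (int r dvd i - fst s \<and> int p dvd z - snd s)"
  have "\<exists>g. realizes q g (\<lambda>i. 0) (?\<delta> s)" if s: "s \<in> ?box" for s
  proof -
    obtain i0 z0 where s_eq: "s = (i0, z0)" and i0: "0 \<le> i0" by (use s in auto)
    obtain m where m: "[m = 0] (mod p)" "[m = nat (t i0 z0 mod int q)] (mod q)"
      using binary_chinese_remainder_nat[OF assms(1)] by blast
    have mq: "[int m = t i0 z0] (mod int q)"
    proof -
      have "[int m = int (nat (t i0 z0 mod int q))] (mod int q)"
        using m(2) by (simp only: cong_int_iff)
      then show ?thesis using assms(2) by (simp add: cong_def)
    qed
    have mp: "[int m = 0] (mod int p)"
      using m(1) by (metis cong_int_iff of_nat_0)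
    have x: "realizes q (\<beta> [^] m) (\<lambda>i. 0)
        (\<lambda>i z. t i0 z0 * of_bool ([i = 1] (mod int r) \<and> int p dvd z))"
      unfolding realizes_def beta_pow using mp mq
      by (auto intro: cong_scalar_right simp: beta cong_0_iff)
    obtain v where v: "realizes q v (\<lambda>i. z0) (\<lambda>i z. 0)"
      using realizes_turn[OF assms(1), of "\<lambda>i. z0"] by (auto simp: periodic_section_def)
    \<comment> \<open>The class of \<open>i0 - 1\<close>, made nonnegative; it leads from \<open>1\<close> to \<open>i0\<close> modulo \<open>r\<close>.\<close>
    define n where "n = nat (i0 + int r - 1)"
    define y where "y = \<alpha> [^] n \<otimes> v"
    have n: "int n = i0 + int r - 1" using i0 r_pos by (simp add: n_def)
    have vG: "v \<in> carrier G" "shift v = 0" "[turn v i = z0] (mod int p)" for i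
      using v by (simp_all add: realizes_def)
    have y: "y \<in> carrier G" "shift y = int n" "turn y i = turn v i" for i
      using vG alpha(1) by (simp_all add: y_def shift_mult turn_mult alpha_pow)
    have "[i - int n = 1] (mod int r) \<longleftrightarrow> int r dvd i - i0" for i
    proof -
      have "i - int n - 1 = (i - i0) + (- int r)" using n by simp
      then show ?thesis by (simp only: cong_iff_dvd_diff) (simp only: dvd_add_left_iff dvd_minus_iff dvd_refl)
    qed
    moreover have "int p dvd z - turn y i \<longleftrightarrow> int p dvd z - z0" for z i
    proof -
      have "int p dvd turn v i - z0" using vG(3) by (simp add: cong_iff_dvd_diff)
      moreover have "z - z0 = (z - turn v i) + (turn v i - z0)" by simp
      ultimately have "int p dvd z - z0 \<longleftrightarrow> int p dvd z - turn v i"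
        by (simp only: dvd_add_left_iff)
      then show ?thesis by (simp add: y)
    qed
    ultimately show ?thesis
      using realizes_conj[OF x y(1)] by (auto simp: y(2) s_eq)
  qed
  then have "\<exists>g. realizes q g (\<lambda>i. 0) (\<lambda>i z. \<Sum>s\<in>?box. ?\<delta> s i z)"
    by (intro realizes_sum_lift) auto
  moreover have "(\<Sum>s\<in>?box. ?\<delta> s i z) = t i z" for i z
  proof -
    have "int r dvd i - fst s \<and> int p dvd z - snd s \<longleftrightarrow> s = (i mod int r, z mod int p)"
      if "s \<in> ?box" for s
      using that by (auto simp: mod_eq_dvd_iff[symmetric])
    then have "(\<Sum>s\<in>?box. ?\<delta> s i z) =
        (\<Sum>s\<in>?box. if s = (i mod int r, z mod int p) then t (fst s) (snd s) else 0)"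
      by (intro sum.cong) auto
    also have "\<dots> = t (i mod int r) (z mod int p)" using r_pos p_pos by simp
    also have "\<dots> = t i z"
    proof -
      have "[i mod int r = i] (mod int r)" "[z mod int p = z] (mod int p)"
        by (simp_all add: cong_def)
      then show ?thesis using t unfolding periodic_def by blast
    qed
    finally show ?thesis .
  qed
  ultimately show ?thesis by simp
qed

lemma realizes_all:
  assumes "coprime p q" "q > 0" "periodic_section b" "periodic t"
  shows "\<exists>g. realizes q g b t"
proof -
  obtain g h where "realizes q g b (\<lambda>i z. 0)" "realizes q h (\<lambda>i. 0) t"
    using realizes_turn realizes_lift assms by meson
  from realizes_mult[OF this] show ?thesis by auto
qed

text \<open>
The index is the size of the orbit of \<open>\<psi>\<close>, modulo \<open>p\<close>, under \<open>stab q w\<close>. This orbit consists of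
all \<open>p ^ r\<close> sections, because a rotation that turns \<open>\<psi>\<close> into any given section can be corrected
by a lift so as to preserve \<open>w\<close>.
\<close>

lemma index_stab_add_section:
  assumes "coprime p q" "q > 0" "\<not> int q dvd c"
    and w: "periodic w" and \<psi>: "periodic_section \<psi>"
  shows "subgroup_index G (stab q w) (stab q w \<inter> stab q (add_section c \<psi> w)) = p ^ r"
proof -
  let ?f = "\<lambda>x. restrict (\<lambda>i. pull_section x \<psi> i mod int p) {0..<int r}"
  have per: "periodic_section (pull_section x \<psi>)" if "x \<in> carrier G" for x
    unfolding periodic_section_def
  proof (intro allI impI)
    fix i j assume ij: "[i = j] (mod int r)"
    then have "turn x i = turn x j" "\<psi> (i + shift x) = \<psi> (j + shift x)"
      using turn_periodic that \<psi> unfolding periodic_section_def by (auto simp: cong_add_rcancel)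
    then show "pull_section x \<psi> i = pull_section x \<psi> j" by (simp add: pull_section_def)
  qed
  have eq_iff: "?f x = ?f y \<longleftrightarrow> x \<otimes> inv y \<in> stab q w \<inter> stab q (add_section c \<psi> w)"
    if xy: "x \<in> stab q w" "y \<in> stab q w" for x y
  proof -
    have "?f x = ?f y \<longleftrightarrow> (\<forall>i. [pull_section x \<psi> i = pull_section y \<psi> i] (mod int p))"
    proof
      assume eq: "?f x = ?f y"
      show "\<forall>i. [pull_section x \<psi> i = pull_section y \<psi> i] (mod int p)"
      proof
        fix i
        have "i mod int r \<in> {0..<int r}" using r_pos by simp
        then have "[pull_section x \<psi> (i mod int r) = pull_section y \<psi> (i mod int r)] (mod int p)"
          using fun_cong[OF eq, of "i mod int r"] by (simp add: cong_def)
        moreover have "[i = i mod int r] (mod int r)" by (simp add: cong_def)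
        ultimately show "[pull_section x \<psi> i = pull_section y \<psi> i] (mod int p)"
          using per[of x] per[of y] xy stab_carrier unfolding periodic_section_def
          by (metis subsetD)
      qed
    qed (auto simp: restrict_def cong_def fun_eq_iff)
    also have "\<dots> \<longleftrightarrow> x \<otimes> inv y \<in> stab q (add_section c \<psi> w)"
      using mult_inv_mem_stab_add_section_iff[OF assms(3) xy] by simp
    also have "\<dots> \<longleftrightarrow> x \<otimes> inv y \<in> stab q w \<inter> stab q (add_section c \<psi> w)"
      using xy subgroup_stab by (simp add: subgroup.m_closed subgroup.m_inv_closed)
    finally show ?thesis .
  qed
  have "?f ` stab q w = {0..<int r} \<rightarrow>\<^sub>E {0..<int p}"
  proof
    show "?f ` stab q w \<subseteq> {0..<int r} \<rightarrow>\<^sub>E {0..<int p}"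
      using p_pos by auto
    show "{0..<int r} \<rightarrow>\<^sub>E {0..<int p} \<subseteq> ?f ` stab q w"
    proof
      fix \<chi> :: "int \<Rightarrow> int" assume \<chi>: "\<chi> \<in> {0..<int r} \<rightarrow>\<^sub>E {0..<int p}"
      define b where "b i = \<psi> i - \<chi> (i mod int r)" for i
      \<comment> \<open>The correction that makes an element with rotation \<open>b\<close> preserve the graph of \<open>w\<close>.\<close>
      define t where "t i z = w i (z + b i) - w i z" for i z
      have b: "periodic_section b"
        unfolding periodic_section_def
      proof (intro allI impI)
        fix i j assume ij: "[i = j] (mod int r)"
        then have "i mod int r = j mod int r" by (simp add: cong_def)
        moreover have "\<psi> i = \<psi> j" using ij \<psi> unfolding periodic_section_def by blast
        ultimately show "b i = b j" by (simp add: b_def)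
      qed
      have t: "periodic t"
        unfolding periodic_def
      proof (intro allI impI)
        fix i j z z' assume ij: "[i = j] (mod int r)" "[z = z'] (mod int p)"
        then have "b i = b j" using b unfolding periodic_section_def by blast
        moreover have "w i (z + b j) = w j (z' + b j)" "w i z = w j z'"
          using w ij(1) ij(2) cong_add[OF ij(2) cong_refl[of "b j"]]
          unfolding periodic_def by blast+
        ultimately show "t i z = t j z'" by (simp add: t_def)
      qed
      obtain g where g: "realizes q g b t" using realizes_all assms(1,2) b t by blast
      then have gG: "g \<in> carrier G" "shift g = 0" and turn: "[turn g i = b i] (mod int p)"
        and lift: "[lift g i z = t i z] (mod int q)" for i z
        by (simp_all add: realizes_def)
      have "[pull g w i z = w i z] (mod int q)" for i z
      proof -
        have "w i (z + turn g i) = w i (z + b i)"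
          using w cong_add[OF cong_refl[of z] turn[of i]] cong_refl[of i]
          unfolding periodic_def by blast
        then have "pull g w i z = w i (z + b i) - lift g i z" using gG by (simp add: pull_def)
        moreover have "[w i (z + b i) - lift g i z = w i (z + b i) - t i z] (mod int q)"
          by (rule cong_diff[OF cong_refl lift])
        ultimately show ?thesis by (simp add: t_def)
      qed
      then have "g \<in> stab q w" using gG by (simp add: stab_def)
      moreover have "?f g = \<chi>"
      proof
        fix i
        show "?f g i = \<chi> i"
        proof (cases "i \<in> {0..<int r}")
          case True
          have "[\<psi> i - turn g i = \<psi> i - b i] (mod int p)" by (rule cong_diff[OF cong_refl turn])
          then have "pull_section g \<psi> i mod int p = \<chi> i mod int p"
            using True gG by (simp add: pull_section_def b_def cong_def)
          also have "\<dots> = \<chi> i" using \<chi> True by (auto simp: PiE_def Pi_def)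
          finally show ?thesis using True by simp
        qed (use \<chi> in auto)
      qed
      ultimately show "\<chi> \<in> ?f ` stab q w" by blast
    qed
  qed
  moreover have "subgroup (stab q w \<inter> stab q (add_section c \<psi> w)) G"
    using subgroup_stab by (intro subgroups_Inter_pair)
  ultimately show ?thesis
    using subgroup_index_eq_card_image[OF subgroup_stab _ eq_iff] by (simp add: card_funcsetE)
qed

end

section \<open>Walks in local commensurability graphs\<close>

lemma nth_mem_vwalk_arcs:
  "Suc j < length vs \<Longrightarrow> (vs ! j, vs ! Suc j) \<in> set (vwalk_arcs vs)"
proof (induction vs arbitrary: j rule: vwalk_arcs.induct)
  case (3 x y xs)
  then show ?case by (cases j) auto
qed auto

lemma (in wf_digraph) geodesic_exists:
  assumes "u \<rightarrow>\<^sup>*\<^bsub>G\<^esub> v"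
  shows "\<exists>q. geodesic G q \<and> hd q = u \<and> last q = v"
proof -
  let ?P = "\<lambda>n. \<exists>q. vpath q G \<and> hd q = u \<and> last q = v \<and> vwalk_length q = n"
  have "\<exists>n. ?P n" using assms reachable_vpath_conv by blast
  then have "?P (LEAST n. ?P n)" by (rule LeastI_ex)
  then show ?thesis unfolding geodesic_def path_distance_def by blast
qed

lemma sym_digraph_local_comm_graph: "sym_digraph (with_proj (local_comm_graph p G))"
proof -
  interpret pair_bidirected_digraph "local_comm_graph p G"
    by (rule pair_bidirected_local_comm_graph)
  show ?thesis by unfold_locales
qed

lemma wf_digraph_local_comm_graph: "wf_digraph (with_proj (local_comm_graph p G))"
  using sym_digraph_local_comm_graph by (rule sym_digraph.axioms(1))

text \<open>
All that the lower bound uses about an edge is that both indices are prime to every prime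
\<open>l \<noteq> p\<close>.
\<close>

lemma local_comm_graph_adjacent_index:
  assumes "prime p" "prime l" "l \<noteq> p" "(A, B) \<in> parcs (local_comm_graph p G)"
  shows "subgroup A G" "subgroup B G"
    "\<not> l dvd subgroup_index G A (A \<inter> B)" "\<not> l dvd subgroup_index G B (A \<inter> B)"
proof -
  show "subgroup A G" "subgroup B G"
    using assms(4) by (simp_all add: local_comm_graph_def finite_index_subgroups_def)
  obtain k where k: "subgroup_index G A (A \<inter> B) * subgroup_index G B (A \<inter> B) = p ^ k"
    using assms(4) by (auto simp: local_comm_graph_def)
  have "\<not> l dvd p ^ k"
    using assms by (metis prime_dvd_power primes_dvd_imp_eq)
  then show "\<not> l dvd subgroup_index G A (A \<inter> B)" "\<not> l dvd subgroup_index G B (A \<inter> B)"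
    unfolding k[symmetric] by auto
qed

section \<open>Invariants of components and the pigeonhole argument\<close>

context skew_shift_action
begin

text \<open>
For a subgroup \<open>A\<close>, this says that in the action of \<open>A\<close> on the residues modulo \<open>(r, p, q)\<close> the
stabilizer of a point \<open>(i, z)\<close> fixes every point above it.
\<close>

definition anchored :: "nat \<Rightarrow> 'a set \<Rightarrow> bool" where
  "anchored q A \<longleftrightarrow>
     (\<forall>g\<in>A. \<forall>i z. int r dvd shift g \<longrightarrow> int p dvd turn g i \<longrightarrow> int q dvd lift g i z)"

text \<open>
Suppose \<open>g \<in> A\<close> fixes \<open>(i, z)\<close> and translates the fibre over it by \<open>c\<close>. Some conjugate of \<open>g\<^sup>j\<close>
with \<open>j\<close> prime to \<open>q\<close> lies in \<open>B\<close>; it fixes a point and translates its fibre by \<open>j c\<close>. So \<open>q\<close>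
divides \<open>j c\<close>, hence \<open>c\<close>.
\<close>

lemma anchored_if_coprime_index:
  assumes A: "subgroup A G" and B: "subgroup B G" and "prime q"
    and index: "\<not> q dvd subgroup_index G A B" and anch: "anchored q B"
  shows "anchored q A"
  unfolding anchored_def
proof (intro ballI allI impI)
  fix g i z assume g: "g \<in> A" "int r dvd shift g" "int p dvd turn g i"
  obtain y j where y: "y \<in> A" and j: "\<not> q dvd j" and mem: "y \<otimes> g [^] j \<otimes> inv y \<in> B"
    using conj_power_in_subgroup_coprime_index[OF A B g(1) index] by metis
  have gG: "g \<in> carrier G" "g [^] j \<in> carrier G" and yG: "y \<in> carrier G"
    using g y A by (auto dest: subgroup.mem_carrier)
  have s: "int r dvd shift (g [^] j)" and t: "int p dvd turn (g [^] j) i"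
    using g gG by (simp_all add: shift_pow fixing_pow)
  have "int q dvd lift (y \<otimes> g [^] j \<otimes> inv y) (i + shift y) (z + turn y i)"
    using anch mem s t unfolding anchored_def
    by (metis gG(2) shift_conj turn_conj yG)
  then have "int q dvd int j * lift g i z"
    using lift_conj_fixing[OF gG(2) yG s t] fixing_pow(2)[OF gG(1) g(2,3)] by simp
  then show "int q dvd lift g i z"
    using j \<open>prime q\<close> by (simp add: prime_dvd_mult_iff)
qed

text \<open>
A conjugate of \<open>g\<^sup>j\<close> in \<open>B\<close> has shift \<open>j\<close> modulo \<open>r\<close>, which is invertible if \<open>j\<close> is prime to \<open>r\<close>.
A suitable power has shift \<open>1\<close>.
\<close>

lemma unit_shift_if_coprime_index:
  assumes A: "subgroup A G" and B: "subgroup B G" and index: "\<not> r dvd subgroup_index G A B"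
    and g: "g \<in> A" "[shift g = 1] (mod int r)"
  shows "\<exists>h\<in>B. [shift h = 1] (mod int r)"
proof -
  obtain y j where y: "y \<in> A" and j: "\<not> r dvd j" and mem: "y \<otimes> g [^] j \<otimes> inv y \<in> B"
    using conj_power_in_subgroup_coprime_index[OF A B g(1) index] by metis
  let ?h = "y \<otimes> g [^] j \<otimes> inv y"
  have G: "g \<in> carrier G" "y \<in> carrier G" "?h \<in> carrier G"
    using g(1) y mem A B by (auto dest: subgroup.mem_carrier)
  have "coprime j r" using j prime_r by (metis coprime_commute prime_imp_coprime)
  then obtain m where m: "[j * m = Suc 0] (mod r)" using cong_solve_coprime_nat by blast
  have "?h [^] m \<in> B"
    by (induction m) (use mem B in \<open>simp_all add: subgroup.one_closed subgroup.m_closed\<close>)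
  moreover have "[shift (?h [^] m) = 1] (mod int r)"
  proof -
    have "shift (?h [^] m) = int (j * m) * shift g"
      using G by (simp add: shift_pow shift_conj)
    moreover have "[int (j * m) = 1] (mod int r)"
      using m by (metis One_nat_def cong_int_iff of_nat_1)
    ultimately show ?thesis using cong_mult[OF _ g(2)] by fastforce
  qed
  ultimately show ?thesis by blast
qed

text \<open>
The quotient \<open>u\<^sup>-\<^sup>1 v\<close> fixes the points over \<open>i\<close>, so it cannot translate their fibres.
\<close>

lemma anchored_same_displacement:
  assumes A: "subgroup A G" and anch: "anchored q A" and uv: "u \<in> A" "v \<in> A"
    and s: "[shift u = shift v] (mod int r)" and t: "int p dvd turn u i" "int p dvd turn v i"
  shows "[lift u i z = lift v i z] (mod int q)"
proof -
  have G: "u \<in> carrier G" "v \<in> carrier G" using uv A by (auto dest: subgroup.mem_carrier)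
  have mem: "inv u \<otimes> v \<in> A" using uv A by (simp add: subgroup.m_closed subgroup.m_inv_closed)
  have i: "[i + shift v = i + shift u] (mod int r)"
    using cong_add[OF cong_refl[of i] cong_sym[OF s]] .
  have z: "[z + turn v i = z + turn u i] (mod int p)"
    using t by (intro cong_add) (simp_all add: cong_iff_dvd_diff)
  have "int r dvd shift (inv u \<otimes> v)"
    using s G by (simp add: shift_mult shift_inv cong_iff_dvd_diff dvd_diff_commute)
  moreover have "int p dvd turn (inv u \<otimes> v) i"
    using t G turn_periodic[OF inv_closed[OF G(1)] i] by (simp add: turn_mult turn_inv)
  ultimately have "int q dvd lift (inv u \<otimes> v) i z"
    using anch mem by (simp add: anchored_def)
  moreover have "lift (inv u \<otimes> v) i z = lift v i z - lift u i z"
    using G lift_periodic[OF inv_closed[OF G(1)] i z] by (simp add: lift_mult lift_inv)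
  ultimately show ?thesis by (simp add: cong_iff_dvd_diff dvd_diff_commute)
qed

text \<open>
This is the core of the lower bound. For each \<open>k < r\<close>, the power \<open>g\<^sub>j\<^sup>k\<close> maps the fibre over \<open>0\<close> to
the fibre over \<open>k\<close> with a rotation in \<open>C\<^sub>p\<close>. As \<open>j\<close> ranges over \<open>0, \<dots>, n\<close>, this attaches to \<open>k\<close> one
of \<open>p\<^bsup>n+1\<^esup> < r\<close> tuples, so two exponents \<open>k < k'\<close> get the same tuple. The elements \<open>g\<^sub>j\<^bsup>k'-k\<^esup>\<close> then
do not rotate the fibre over \<open>k\<close>, and consecutive ones can be compared inside the anchored
subgroup that contains both.
\<close>

lemma common_displacement:
  fixes A :: "nat \<Rightarrow> 'a set" and g :: "nat \<Rightarrow> 'a"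
  assumes A: "\<And>j. j \<le> n \<Longrightarrow> subgroup (A j) G" "\<And>j. j \<le> n \<Longrightarrow> anchored q (A j)"
    and g: "\<And>j. j \<le> n \<Longrightarrow> g j \<in> A j" "\<And>j. j < n \<Longrightarrow> g j \<in> A (Suc j)"
      "\<And>j. j \<le> n \<Longrightarrow> [shift (g j) = 1] (mod int r)"
    and small: "p ^ Suc n < r"
  obtains i i' x y where "0 \<le> i" "i < i'" "i' < int r" "x \<in> A 0" "y \<in> A n"
    "[i + shift x = i'] (mod int r)" "[i + shift y = i'] (mod int r)"
    "int p dvd turn x i" "int p dvd turn y i" "\<And>z. [lift x i z = lift y i z] (mod int q)"
proof -
  \<comment> \<open>The tuple of rotations, modulo \<open>p\<close>, from the fibre over \<open>0\<close> to the fibre over \<open>k\<close>.\<close>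
  define F where "F k = restrict (\<lambda>j. turn (g j [^] k) 0 mod int p) {..n}" for k :: nat
  have "F ` {..<r} \<subseteq> {..n} \<rightarrow>\<^sub>E {0..<int p}" using p_pos by (auto simp: F_def split: if_splits)
  then have "card (F ` {..<r}) \<le> card ({..n} \<rightarrow>\<^sub>E {0..<int p})"
    by (intro card_mono finite_PiE) auto
  also have "\<dots> < card {..<r}" using small by (simp add: card_funcsetE)
  finally have "\<not> inj_on F {..<r}" by (rule pigeonhole)
  then have "\<exists>k k'. k < k' \<and> k' < r \<and> F k = F k'"
    unfolding inj_on_def by (metis lessThan_iff nat_neq_iff)
  then obtain k k' where k: "k < k'" "k' < r" "F k = F k'" by blast
  define \<delta> where "\<delta> j = g j [^] (k' - k)" for j
  have gG: "g j \<in> carrier G" if "j \<le> n" for j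
    using A(1)[OF that] g(1)[OF that] by (rule subgroup.mem_carrier)
  have shift_\<delta>: "[shift (\<delta> j) = int k' - int k] (mod int r)" if "j \<le> n" for j
  proof -
    have "[int (k' - k) * shift (g j) = int (k' - k) * 1] (mod int r)"
      by (rule cong_mult[OF cong_refl g(3)[OF that]])
    then show ?thesis using k(1) gG[OF that] by (simp add: \<delta>_def shift_pow of_nat_diff)
  qed
  have turn_\<delta>: "int p dvd turn (\<delta> j) (int k)" if "j \<le> n" for j
  proof -
    have "g j [^] k' = \<delta> j \<otimes> g j [^] k"
      using k(1) gG[OF that] by (simp add: \<delta>_def nat_pow_mult)
    then have "turn (g j [^] k') 0 = turn (g j [^] k) 0 + turn (\<delta> j) (int k * shift (g j))"
      using gG[OF that] by (simp add: \<delta>_def turn_mult shift_pow)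
    also have "turn (\<delta> j) (int k * shift (g j)) = turn (\<delta> j) (int k)"
      using cong_mult[OF cong_refl[of "int k"] g(3)[OF that]] gG[OF that]
      by (intro turn_periodic) (simp_all add: \<delta>_def)
    finally have eq: "turn (\<delta> j) (int k) = turn (g j [^] k') 0 - turn (g j [^] k) 0" by simp
    have "turn (g j [^] k) 0 mod int p = turn (g j [^] k') 0 mod int p"
      using fun_cong[OF k(3), of j] that by (simp add: F_def)
    then show ?thesis unfolding eq by (metis mod_eq_dvd_iff)
  qed
  have mem: "\<delta> j \<in> H" if "subgroup H G" "g j \<in> H" for j H
  proof -
    have "g j [^] m \<in> H" for m :: nat
      by (induction m) (use that in \<open>simp_all add: subgroup.one_closed subgroup.m_closed\<close>)
    then show ?thesis by (simp add: \<delta>_def)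
  qed
  have step: "[lift (\<delta> j) (int k) z = lift (\<delta> (Suc j)) (int k) z] (mod int q)" if "j < n" for j z
  proof (rule anchored_same_displacement)
    show "subgroup (A (Suc j)) G" "anchored q (A (Suc j))" using A that by simp_all
    show "\<delta> j \<in> A (Suc j)" "\<delta> (Suc j) \<in> A (Suc j)" using mem A g that by simp_all
    show "[shift (\<delta> j) = shift (\<delta> (Suc j))] (mod int r)"
      using cong_trans[OF shift_\<delta> cong_sym[OF shift_\<delta>]] that by simp
    show "int p dvd turn (\<delta> j) (int k)" "int p dvd turn (\<delta> (Suc j)) (int k)"
      using turn_\<delta> that by simp_all
  qed
  have "[lift (\<delta> 0) (int k) z = lift (\<delta> j) (int k) z] (mod int q)" if "j \<le> n" for j z
    using that
  proof (induction j)
    case (Suc j)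
    then show ?case using cong_trans[OF Suc.IH step] by simp
  qed simp
  moreover have "[int k + shift (\<delta> j) = int k'] (mod int r)" if "j \<le> n" for j
    using cong_add[OF cong_refl[of "int k"] shift_\<delta>[OF that]] by simp
  ultimately show thesis
    using that[of "int k" "int k'" "\<delta> 0" "\<delta> n"] k mem A g turn_\<delta> by simp
qed

text \<open>
An element that preserves the graph of \<open>w\<close> and fixes \<open>(i, z)\<close> must fix the point of the graph
above \<open>(i, z)\<close>, which leaves no room for a translation of the fibre.
\<close>

lemma anchored_stab:
  assumes "periodic w"
  shows "anchored q (stab q w)"
  unfolding anchored_def
proof (intro ballI allI impI)
  fix g i z assume g: "g \<in> stab q w" "int r dvd shift g" "int p dvd turn g i"
  have "[i + shift g = i] (mod int r)" "[z + turn g i = z] (mod int p)"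
    using g by (simp_all add: cong_iff_dvd_diff)
  then have "w (i + shift g) (z + turn g i) = w i z"
    using assms unfolding periodic_def by blast
  then have "[w i z - lift g i z = w i z] (mod int q)"
    using g(1) by (simp add: stab_def pull_def) metis
  then show "int q dvd lift g i z" by (simp add: cong_iff_dvd_diff)
qed

abbreviation graph :: "('a set, 'a set \<times> 'a set) pre_digraph" where
  "graph \<equiv> with_proj (local_comm_graph p G)"

lemma anchored_adjacent:
  assumes "(A, B) \<in> parcs (local_comm_graph p G)" "prime q" "q \<noteq> p" "anchored q A"
  shows "anchored q B"
proof -
  note idx = local_comm_graph_adjacent_index[OF prime_p assms(2,3,1)]
  have "anchored q (A \<inter> B)" using assms(4) by (simp add: anchored_def)
  then show ?thesis
    using anchored_if_coprime_index[OF idx(2) subgroups_Inter_pair[OF idx(1,2)] assms(2) idx(4)]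
    by blast
qed

lemma unit_shift_adjacent:
  assumes "(A, B) \<in> parcs (local_comm_graph p G)" "g \<in> A" "[shift g = 1] (mod int r)"
  shows "\<exists>h\<in>A \<inter> B. [shift h = 1] (mod int r)"
proof -
  note idx = local_comm_graph_adjacent_index[OF prime_p prime_r r_neq_p assms(1)]
  show ?thesis
    using unit_shift_if_coprime_index[OF idx(1) subgroups_Inter_pair[OF idx(1,2)] idx(3) assms(2,3)] .
qed

lemma anchored_reachable:
  assumes "A \<rightarrow>\<^sup>*\<^bsub>graph\<^esub> B" "prime q" "q \<noteq> p" "anchored q A"
  shows "anchored q B"
  using assms(1)
proof (induction rule: wf_digraph.reachable_induct[OF wf_digraph_local_comm_graph, consumes 1, case_names base step])
  case base
  show ?case by (rule assms(4))
next
  case (step B C)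
  then show ?case using anchored_adjacent assms(2,3) by auto
qed

text \<open>
The elements required by \<open>common_displacement\<close> are found by walking along the path: an element
with shift \<open>1\<close> in one vertex yields one in the intersection with the next vertex.
\<close>

lemma walk_common_displacement:
  assumes vs: "vwalk vs graph" and q: "prime q" "q \<noteq> p" and anch: "anchored q (hd vs)"
    and g: "g \<in> hd vs" "[shift g = 1] (mod int r)" and small: "p ^ length vs < r"
  obtains i i' x y where "0 \<le> i" "i < i'" "i' < int r" "x \<in> hd vs" "y \<in> last vs"
    "[i + shift x = i'] (mod int r)" "[i + shift y = i'] (mod int r)"
    "int p dvd turn x i" "int p dvd turn y i" "\<And>z. [lift x i z = lift y i z] (mod int q)"
proof -
  define n where "n = length vs - 1"
  have ne: "vs \<noteq> []" and len: "length vs = Suc n" using vs by (auto simp: n_def vwalk_def)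
  have sub: "subgroup (vs ! j) G" if "j \<le> n" for j
  proof -
    have "vs ! j \<in> finite_index_subgroups G"
      using vs that len by (auto simp: vwalk_def local_comm_graph_def)
    then show ?thesis by (simp add: finite_index_subgroups_def)
  qed
  have adj: "(vs ! j, vs ! Suc j) \<in> parcs (local_comm_graph p G)" if "j < n" for j
    using nth_mem_vwalk_arcs[of j vs] that len vs by (auto simp: vwalk_def)
  have ind: "anchored q (vs ! j) \<and> (\<exists>h\<in>vs ! j. [shift h = 1] (mod int r))" if "j \<le> n" for j
    using that
  proof (induction j)
    case 0
    then show ?case using anch g ne by (auto simp: hd_conv_nth)
  next
    case (Suc j)
    then have "j < n" "anchored q (vs ! j)" "\<exists>h\<in>vs ! j. [shift h = 1] (mod int r)" by simp_all
    then show ?case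
      using anchored_adjacent[OF adj q] unit_shift_adjacent[OF adj] by blast
  qed
  have "\<exists>h. h \<in> vs ! j \<and> (j < n \<longrightarrow> h \<in> vs ! Suc j) \<and> [shift h = 1] (mod int r)" if "j \<le> n" for j
    using ind[OF that] unit_shift_adjacent[OF adj] by (cases "j < n") blast+
  then obtain h where h: "\<And>j. j \<le> n \<Longrightarrow>
      h j \<in> vs ! j \<and> (j < n \<longrightarrow> h j \<in> vs ! Suc j) \<and> [shift (h j) = 1] (mod int r)"
    by metis
  have hd: "hd vs = vs ! 0" and last: "last vs = vs ! n"
    using ne by (simp_all add: n_def hd_conv_nth last_conv_nth)
  show thesis
  proof (rule common_displacement[of n "\<lambda>j. vs ! j" q h])
    show "p ^ Suc n < r" using small len by simp
    show "subgroup (vs ! j) G" if "j \<le> n" for j using that by (rule sub)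
    show "anchored q (vs ! j)" if "j \<le> n" for j using ind that by blast
    show "h j \<in> vs ! j" "[shift (h j) = 1] (mod int r)" if "j \<le> n" for j using h that by blast+
    show "h j \<in> vs ! Suc j" if "j < n" for j using h[of j] that by simp
  qed (rule that[unfolded hd last]; assumption)
qed

end

section \<open>Long geodesics between stabilizers\<close>

context generated_skew_shift_action
begin

text \<open>
Since \<open>w\<close> arises from \<open>w + c \<cdot> 1\<^sub>\<psi>\<close> by adding \<open>- c \<cdot> 1\<^sub>\<psi>\<close>, one index formula serves for both
ends of the edge. If \<open>q\<close> divides \<open>c\<close>, the two stabilizers coincide.
\<close>

lemma reachable_add_section:
  assumes q: "prime q" "q \<noteq> p" and w: "periodic w" and \<psi>: "periodic_section \<psi>"
  shows "stab q w \<rightarrow>\<^sup>*\<^bsub>graph\<^esub> stab q (add_section c \<psi> w)"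
proof -
  let ?A = "stab q w" and ?B = "stab q (add_section c \<psi> w)"
  have copr: "coprime p q" using q prime_p by (metis primes_coprime)
  have q0: "q > 0" using q by (simp add: prime_gt_0_nat)
  have w': "periodic (add_section c \<psi> w)" using w \<psi> by (rule periodic_add_section)
  have verts: "?A \<in> finite_index_subgroups G" "?B \<in> finite_index_subgroups G"
    using stab_finite_index w w' q0 by auto
  show ?thesis
  proof (cases "?A = ?B")
    case True
    have "?A \<in> verts graph" using verts by (simp add: local_comm_graph_def)
    then show ?thesis using True by (simp add: reachable_def)
  next
    case False
    have c: "\<not> int q dvd c"
    proof
      assume "int q dvd c"
      then have "[w i z + c * section_indicator \<psi> i z = w i z] (mod int q)" for i z
        by (simp add: cong_iff_dvd_diff)
      then have cong: "[add_section c \<psi> w i z = w i z] (mod int q)" for i z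
        by (simp add: add_section_def)
      have "[pull g (add_section c \<psi> w) i z = add_section c \<psi> w i z] (mod int q) \<longleftrightarrow>
            [pull g w i z = w i z] (mod int q)" for g i z
        using pull_cong[OF cong, where g = g and i = i and z = z] cong[of i z] by (simp add: cong_def)
      then show False using False by (simp add: stab_def)
    qed
    have "add_section (- c) \<psi> (add_section c \<psi> w) = w"
      by (intro ext) (simp add: add_section_def)
    then have "subgroup_index G ?B (?A \<inter> ?B) = p ^ r"
      using index_stab_add_section[OF copr q0, of "- c" "add_section c \<psi> w" \<psi>] c w' \<psi>
      by (simp add: Int_commute)
    moreover have "subgroup_index G ?A (?A \<inter> ?B) = p ^ r"
      using index_stab_add_section[OF copr q0 c w \<psi>] .
    ultimately have "subgroup_index G ?A (?A \<inter> ?B) * subgroup_index G ?B (?A \<inter> ?B) = p ^ (r + r)"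
      by (simp add: power_add)
    then have "(?A, ?B) \<in> parcs (local_comm_graph p G)"
      using verts False by (auto simp: local_comm_graph_def)
    then show ?thesis
      by (intro wf_digraph.reachable_adjI[OF wf_digraph_local_comm_graph]) simp
  qed
qed

definition pulse :: "nat \<Rightarrow> int \<Rightarrow> int" where
  "pulse m i = of_bool (int r dvd i - int m)"

text \<open>
Subtracting the indicator of the zero section removes the step that the pulse adds outside the
class of \<open>m\<close>. Over that class, the value rises by \<open>m\<close> at \<open>z \<equiv> 1\<close> and falls by \<open>m\<close> at \<open>z \<equiv> 0\<close>.
\<close>

fun staircase :: "nat \<Rightarrow> int \<Rightarrow> int \<Rightarrow> int" where
  "staircase 0 = (\<lambda>i z. 0)"
| "staircase (Suc m) =
     add_section (- int m) (\<lambda>i. 0) (add_section (int m) (pulse m) (staircase m))"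

lemma periodic_section_pulse: "periodic_section (pulse m)"
proof -
  have "int r dvd i - int m \<longleftrightarrow> int r dvd j - int m" if "[i = j] (mod int r)" for i j
    using that by (metis cong_diff cong_dvd_iff cong_refl)
  then show ?thesis by (simp add: periodic_section_def pulse_def)
qed

lemma periodic_staircase: "periodic (staircase m)"
proof (induction m)
  case (Suc m)
  then show ?case
    unfolding staircase.simps
    by (intro periodic_add_section periodic_section_pulse) (simp_all add: periodic_section_def)
qed (simp add: periodic_def)

lemma staircase_reachable:
  assumes "prime q" "q \<noteq> p"
  shows "stab q (\<lambda>i z. 0) \<rightarrow>\<^sup>*\<^bsub>graph\<^esub> stab q (staircase m)"
proof (induction m)
  case 0
  have "periodic (\<lambda>i z. 0)" by (simp add: periodic_def)
  then have "stab q (\<lambda>i z. 0) \<in> verts graph"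
    using stab_finite_index assms by (simp add: local_comm_graph_def prime_gt_0_nat)
  then show ?case by (simp add: reachable_def)
next
  case (Suc m)
  let ?w = "add_section (int m) (pulse m) (staircase m)"
  have w: "periodic ?w"
    by (intro periodic_add_section periodic_staircase periodic_section_pulse)
  have "stab q (staircase m) \<rightarrow>\<^sup>*\<^bsub>graph\<^esub> stab q ?w"
    by (intro reachable_add_section assms periodic_staircase periodic_section_pulse)
  moreover have "stab q ?w \<rightarrow>\<^sup>*\<^bsub>graph\<^esub> stab q (staircase (Suc m))"
    using reachable_add_section[OF assms w, of "\<lambda>i. 0"] by (simp add: periodic_section_def)
  ultimately show ?case
    using Suc wf_digraph.reachable_trans[OF wf_digraph_local_comm_graph] by blast
qed

lemma staircase_at_1:
  assumes "m \<le> r" "0 \<le> i" "i < int r"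
  shows "staircase m i 1 = (if i < int m then i else 0)"
  using assms(1)
proof (induction m)
  case (Suc m)
  have "\<not> [1 = 0] (mod int p)"
    using prime_gt_1_nat[OF prime_p] by (simp add: cong_def)
  moreover have "int r dvd i - int m \<longleftrightarrow> i = int m"
    using Suc.prems assms by (simp add: mod_eq_dvd_iff[symmetric])
  ultimately show ?case
    using Suc by (auto simp: add_section_def section_indicator_def pulse_def)
qed (use assms in simp)

lemma long_geodesic:
  assumes q: "prime q" "q \<noteq> p" "r < q" and small: "p ^ Suc N < r"
  shows "\<exists>\<gamma>. geodesic graph \<gamma> \<and> N < vwalk_length \<gamma> \<and> hd \<gamma> = stab q (\<lambda>i z. 0)"
proof -
  let ?A = "stab q (\<lambda>i z. 0)" and ?B = "stab q (staircase r)"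
  obtain \<gamma> where \<gamma>: "geodesic graph \<gamma>" "hd \<gamma> = ?A" "last \<gamma> = ?B"
    using wf_digraph.geodesic_exists[OF wf_digraph_local_comm_graph staircase_reachable] q
    by metis
  have "N < vwalk_length \<gamma>"
  proof (rule ccontr)
    assume "\<not> ?thesis"
    then have "length \<gamma> \<le> Suc N" by simp
    then have "p ^ length \<gamma> \<le> p ^ Suc N"
      using p_pos by (intro power_increasing) auto
    then have len: "p ^ length \<gamma> < r" using small by simp
    have walk: "vwalk \<gamma> graph" using \<gamma> by (auto simp: geodesic_def vpath_def)
    have anch: "anchored q (hd \<gamma>)"
      unfolding \<gamma>(2) by (rule anchored_stab) (simp add: periodic_def)
    have "\<alpha> \<in> hd \<gamma>" "[shift \<alpha> = 1] (mod int r)"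
      unfolding \<gamma>(2) by (simp_all add: alpha stab_def pull_def)
    then obtain i i' x y where i: "0 \<le> i" "i < i'" "i' < int r"
      and xy: "x \<in> hd \<gamma>" "y \<in> last \<gamma>"
      and shift: "[i + shift x = i'] (mod int r)" "[i + shift y = i'] (mod int r)"
      and turn: "int p dvd turn x i" "int p dvd turn y i"
      and lift: "\<And>z. [lift x i z = lift y i z] (mod int q)"
      using walk_common_displacement[OF walk q(1,2) anch _ _ len] by metis
    \<comment> \<open>Over \<open>z = 1\<close> the displacement is \<open>0\<close> by the first vertex and \<open>i' - i\<close> by the last.\<close>
    have "[pull x (\<lambda>i z. 0) i 1 = 0] (mod int q)" using xy(1) \<gamma>(2) by (simp add: stab_def)
    then have "[lift x i 1 = 0] (mod int q)" by (simp add: pull_def cong_iff_dvd_diff)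
    then have "[lift y i 1 = 0] (mod int q)" using cong_trans[OF cong_sym[OF lift]] by blast
    moreover have "[pull y (staircase r) i 1 = staircase r i 1] (mod int q)"
      using xy(2) \<gamma>(3) by (simp add: stab_def)
    moreover have "staircase r (i + shift y) (1 + turn y i) = staircase r i' 1"
    proof -
      have "[1 + turn y i = 1] (mod int p)" using turn(2) by (simp add: cong_iff_dvd_diff)
      then show ?thesis using periodic_staircase shift(2) unfolding periodic_def by blast
    qed
    ultimately have "int q dvd lift y i 1" "int q dvd (i' - lift y i 1) - i"
      using i by (simp_all add: pull_def staircase_at_1 cong_iff_dvd_diff)
    then have "int q dvd ((i' - lift y i 1) - i) + lift y i 1" by (rule dvd_add[rotated])
    then have "int q dvd i' - i" by simp
    then have "int q \<le> i' - i" using i by (intro zdvd_imp_le) auto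
    then show False using i q(3) by simp
  qed
  then show ?thesis using \<gamma> by blast
qed

text \<open>
The element \<open>\<beta>\<close> raised to the power \<open>p q'\<close> fixes all points modulo \<open>(r, p)\<close> and lifts by \<open>p q'\<close> at
\<open>(1, 0)\<close>. The lift vanishes modulo \<open>q'\<close> but not modulo \<open>q\<close>.
\<close>

lemma component_of_stab_zero_neq:
  assumes q: "prime q" "q \<noteq> p" and q': "prime q'" "q \<noteq> q'"
  shows "component_of graph (stab q (\<lambda>i z. 0)) \<noteq> component_of graph (stab q' (\<lambda>i z. 0))"
proof
  let ?A = "stab q (\<lambda>i z. 0)" and ?A' = "stab q' (\<lambda>i z. 0)"
  assume eq: "component_of graph ?A = component_of graph ?A'"
  have zero: "periodic (\<lambda>i z. 0)" by (simp add: periodic_def)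
  have "?A' \<rightarrow>\<^sup>*\<^bsub>graph\<^esub> ?A'"
    using stab_finite_index[OF zero, of q'] q'
    by (simp add: reachable_def local_comm_graph_def prime_gt_0_nat)
  then have "?A \<rightarrow>\<^sup>*\<^bsub>graph\<^esub> ?A'"
    using eq unfolding component_of_symmetric[OF sym_digraph_local_comm_graph] by blast
  then have anch: "anchored q ?A'"
    using anchored_reachable q anchored_stab[OF zero] by blast
  let ?g = "\<beta> [^] (p * q')"
  have "?g \<in> ?A'" by (simp add: stab_def pull_def beta_pow beta cong_iff_dvd_diff)
  moreover have "int r dvd shift ?g" "int p dvd turn ?g 1" by (simp_all add: beta_pow)
  ultimately have "int q dvd lift ?g 1 0" using anch unfolding anchored_def by blast
  then have "int q dvd int (p * q')" by (simp add: beta_pow)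
  then have "q dvd p * q'" by (simp only: of_nat_dvd_iff)
  then have "q dvd p \<or> q dvd q'" using q(1) by (simp add: prime_dvd_mult_iff)
  then show False using q q' prime_p by (auto dest: primes_dvd_imp_eq)
qed

lemma infinitely_many_long_geodesics:
  assumes small: "p ^ Suc N < r"
  shows "\<exists>\<P>. infinite \<P> \<and>
           (\<forall>\<gamma>\<in>\<P>. geodesic graph \<gamma> \<and> vwalk_length \<gamma> > N) \<and>
           (\<forall>\<gamma>\<in>\<P>. \<forall>\<delta>\<in>\<P>. \<gamma> \<noteq> \<delta> \<longrightarrow>
              component_of graph (hd \<gamma>) \<noteq> component_of graph (hd \<delta>))"
proof -
  \<comment> \<open>The bound makes \<open>q\<close> differ from \<open>p\<close> and exceed \<open>r\<close>.\<close>
  define Q where "Q = {q. prime q \<and> p + r < q}"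
  have "infinite Q"
    unfolding infinite_nat_iff_unbounded
  proof
    fix m
    obtain q where "prime q" "m + (p + r) < q" using bigger_prime by blast
    then show "\<exists>q>m. q \<in> Q" by (auto simp: Q_def intro!: exI[of _ q])
  qed
  have "\<exists>\<gamma>. geodesic graph \<gamma> \<and> N < vwalk_length \<gamma> \<and> hd \<gamma> = stab q (\<lambda>i z. 0)" if "q \<in> Q" for q
    using that by (intro long_geodesic small) (auto simp: Q_def)
  then obtain \<gamma> where \<gamma>: "\<And>q. q \<in> Q \<Longrightarrow>
      geodesic graph (\<gamma> q) \<and> N < vwalk_length (\<gamma> q) \<and> hd (\<gamma> q) = stab q (\<lambda>i z. 0)"
    by metis
  have comp: "component_of graph (hd (\<gamma> q)) \<noteq> component_of graph (hd (\<gamma> q'))"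
    if "q \<in> Q" "q' \<in> Q" "q \<noteq> q'" for q q'
    using component_of_stab_zero_neq[of q q'] \<gamma> that by (auto simp: Q_def)
  then have "inj_on \<gamma> Q" by (metis inj_onI)
  then have "infinite (\<gamma> ` Q)" using \<open>infinite Q\<close> by (simp add: finite_image_iff)
  moreover have "\<forall>\<gamma>\<in>\<gamma> ` Q. geodesic graph \<gamma> \<and> vwalk_length \<gamma> > N" using \<gamma> by blast
  moreover have "\<forall>x\<in>\<gamma> ` Q. \<forall>y\<in>\<gamma> ` Q. x \<noteq> y \<longrightarrow>
      component_of graph (hd x) \<noteq> component_of graph (hd y)" using comp by blast
  ultimately show ?thesis by blast
qed

end

section \<open>The action of the free group\<close>

type_synonym skew_shift = "int \<times> (int \<Rightarrow> int) \<times> (int \<Rightarrow> int \<Rightarrow> int)"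

text \<open>
Triples are used rather than the permutations of \<open>\<int>\<^sup>3\<close> that they describe, so that the three
coordinates can be read off as projections.
\<close>

definition skew_shift_group :: "nat \<Rightarrow> nat \<Rightarrow> skew_shift monoid" where
  "skew_shift_group r p =
     \<lparr> carrier = {(k, b, t). (\<forall>i j. [i = j] (mod int r) \<longrightarrow> b i = b j) \<and>
         (\<forall>i j z z'. [i = j] (mod int r) \<longrightarrow> [z = z'] (mod int p) \<longrightarrow> t i z = t j z')},
       monoid.mult = (\<lambda>(k', b', t') (k, b, t). (k' + k, \<lambda>i. b i + b' (i + k),
         \<lambda>i z. t i z + t' (i + k) (z + b i))),
       one = (0, \<lambda>i. 0, \<lambda>i z. 0) \<rparr>"

lemma group_skew_shift_group: "group (skew_shift_group r p)"
proof (rule groupI)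
  fix x y assume xy: "x \<in> carrier (skew_shift_group r p)" "y \<in> carrier (skew_shift_group r p)"
  obtain k' b' t' k b t where eq: "x = (k', b', t')" "y = (k, b, t)" by (metis prod_cases3)
  have b: "b i = b j" "b' (i + k) = b' (j + k)" if "[i = j] (mod int r)" for i j
    using xy cong_add[OF that cong_refl] that unfolding eq skew_shift_group_def by auto
  have t: "t i z = t j z'" "t' (i + k) (z + b j) = t' (j + k) (z' + b j)"
    if "[i = j] (mod int r)" "[z = z'] (mod int p)" for i j z z'
    using xy cong_add[OF that(1) cong_refl] cong_add[OF that(2) cong_refl] that
    unfolding eq skew_shift_group_def by auto
  show "x \<otimes>\<^bsub>skew_shift_group r p\<^esub> y \<in> carrier (skew_shift_group r p)"
    unfolding eq skew_shift_group_def by (auto intro!: arg_cong2[of _ _ _ _ "(+)"] simp: b t)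
next
  fix x assume x: "x \<in> carrier (skew_shift_group r p)"
  obtain k b t where eq: "x = (k, b, t)" by (metis prod_cases3)
  have b: "b (i - k) = b (j - k)" if "[i = j] (mod int r)" for i j
    using x cong_diff[OF that cong_refl] unfolding eq skew_shift_group_def by auto
  have t: "t (i - k) (z - b (j - k)) = t (j - k) (z' - b (j - k))"
    if "[i = j] (mod int r)" "[z = z'] (mod int p)" for i j z z'
    using x cong_diff[OF that(1) cong_refl] cong_diff[OF that(2) cong_refl]
    unfolding eq skew_shift_group_def by auto
  let ?y = "(- k, \<lambda>i. - b (i - k), \<lambda>i z. - t (i - k) (z - b (i - k)))"
  have "?y \<in> carrier (skew_shift_group r p)"
    unfolding skew_shift_group_def by (auto simp: b t)
  moreover have "?y \<otimes>\<^bsub>skew_shift_group r p\<^esub> x = \<one>\<^bsub>skew_shift_group r p\<^esub>"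
    unfolding eq skew_shift_group_def by simp
  ultimately show "\<exists>y\<in>carrier (skew_shift_group r p). y \<otimes>\<^bsub>skew_shift_group r p\<^esub> x = \<one>\<^bsub>skew_shift_group r p\<^esub>"
    by blast
qed (auto simp: skew_shift_group_def algebra_simps)

theorem theorem2:
  fixes F :: "('a, 'm) monoid_scheme" and p N :: nat
  assumes "free_group_of_rank F 2" and "prime p" and "N > 0"
  shows "\<exists>\<P>. infinite \<P> \<and>
           (\<forall>\<gamma>\<in>\<P>. geodesic (with_proj (local_comm_graph p F)) \<gamma> \<and> vwalk_length \<gamma> > N) \<and>
           (\<forall>\<gamma>\<in>\<P>. \<forall>\<delta>\<in>\<P>. \<gamma> \<noteq> \<delta> \<longrightarrow>
              component_of (with_proj (local_comm_graph p F)) (hd \<gamma>) \<noteq>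
              component_of (with_proj (local_comm_graph p F)) (hd \<delta>))"
proof -
  obtain r where r: "prime r" "p + p ^ Suc N < r" using bigger_prime by blast
  obtain S where F: "group F" and S: "free_basis F S" "card S = 2"
    using assms(1) by (auto simp: free_group_of_rank_def)
  obtain \<alpha> \<beta> where \<alpha>\<beta>: "S = {\<alpha>, \<beta>}" "\<alpha> \<noteq> \<beta>" using S(2) by (auto simp: card_2_iff)
  have mem: "\<alpha> \<in> carrier F" "\<beta> \<in> carrier F" using S(1) \<alpha>\<beta> by (auto simp: free_basis_def)
  let ?H = "skew_shift_group r p"
  let ?a = "(1, \<lambda>i. 0, \<lambda>i z. 0) :: skew_shift"
  let ?b = "(0, \<lambda>i. of_bool (int r dvd i),
              \<lambda>i z. of_bool ([i = 1] (mod int r) \<and> int p dvd z)) :: skew_shift"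
  have "?b \<in> carrier ?H"
  proof -
    have "int r dvd i \<longleftrightarrow> int r dvd j" if "[i = j] (mod int r)" for i j
      using that by (rule cong_dvd_iff)
    moreover have "[i = 1] (mod int r) \<longleftrightarrow> [j = 1] (mod int r)" if "[i = j] (mod int r)" for i j
      using that by (simp add: cong_def)
    moreover have "int p dvd z \<longleftrightarrow> int p dvd z'" if "[z = z'] (mod int p)" for z z'
      using that by (rule cong_dvd_iff)
    ultimately show ?thesis by (auto simp: skew_shift_group_def)
  qed
  moreover have "?a \<in> carrier ?H" by (simp add: skew_shift_group_def)
  ultimately have "(\<lambda>x. if x = \<alpha> then ?a else ?b) \<in> S \<rightarrow> carrier ?H" by simp
  from free_basis_universal[OF F S(1) group_skew_shift_group this]
  obtain h where h: "h \<in> hom F ?H" "h \<alpha> = ?a" "h \<beta> = ?b"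
    using \<alpha>\<beta> by auto
  have car: "h x \<in> carrier ?H" if "x \<in> carrier F" for x
    using h(1) that by (auto simp: hom_def)
  have mult: "h (x \<otimes>\<^bsub>F\<^esub> y) = h x \<otimes>\<^bsub>?H\<^esub> h y" if "x \<in> carrier F" "y \<in> carrier F" for x y
    using h(1) that by (auto simp: hom_def)
  interpret group F by (rule F)
  interpret generated_skew_shift_action F "\<lambda>x. fst (h x)" "\<lambda>x. fst (snd (h x))"
    "\<lambda>x. snd (snd (h x))" r p \<alpha> \<beta>
  proof
    fix x y i z assume "x \<in> carrier F" "y \<in> carrier F"
    from mult[OF this]
    show "fst (h (x \<otimes>\<^bsub>F\<^esub> y)) = fst (h x) + fst (h y)"
      "fst (snd (h (x \<otimes>\<^bsub>F\<^esub> y))) i = fst (snd (h y)) i + fst (snd (h x)) (i + fst (h y))"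
      "snd (snd (h (x \<otimes>\<^bsub>F\<^esub> y))) i z = snd (snd (h y)) i z +
         snd (snd (h x)) (i + fst (h y)) (z + fst (snd (h y)) i)"
      by (simp_all add: skew_shift_group_def case_prod_beta)
  next
    fix x i j z z' assume x: "x \<in> carrier F" and "[i = j] (mod int r)"
    then show "fst (snd (h x)) i = fst (snd (h x)) j"
      using car[OF x] by (auto simp: skew_shift_group_def case_prod_beta)
  next
    fix x i j z z' assume x: "x \<in> carrier F" and "[i = j] (mod int r)" "[z = z'] (mod int p)"
    then show "snd (snd (h x)) i z = snd (snd (h x)) j z'"
      using car[OF x] by (auto simp: skew_shift_group_def case_prod_beta)
  next
    show "prime r" "prime p" "r \<noteq> p" using r assms(2) by auto
  qed (simp_all add: h mem)
  show ?thesis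
    using infinitely_many_long_geodesics[of N] r(2) by simp
qed

end
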